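(* Let $\epsilon'=(\epsilon'_1,\dots,\epsilon'_{n-1})$ be obtained from $\epsilon$ by removing $\epsilon_i$ for some $i\in\{1,\dots,n\}$, where, if $n=4$, $\epsilon'$ is assumed homogeneous ($\epsilon'=(0,0,0)$ or $(1,1,1)$). Then there exists a homomorphism of $\mathbb{Q}(q)$-algebras $\phi:\mathcal U(\epsilon')\to\mathcal U(\epsilon)$ such that $\phi(k'_j)=K_j$, $\phi(e'_j)=E_j$, $\phi(f'_j)=F_j$ for all $j\in I'=\{0,1,\dots,n-2\}$, where $K_j,E_j,F_j$ are as follows. Case $2\le i\le n-1$: $K_j=k_j$, $E_j=e_j$, $F_j=f_j$ for $j\le i-2$; $K_{i-1}=k_{i-1}k_i$, $E_{i-1}=[e_{i-1},e_i]_{D_{i-1,i}}$, $F_{i-1}=[f_i,f_{i-1}]_{D_{i-1,i}^{-1}}$; $K_j=k_{j+1}$, $E_j=e_{j+1}$, $F_j=f_{j+1}$ for $j\ge i$. Case $i=n$: $K_j=k_j,E_j=e_j,F_j=f_j$ for $j\ne0$; $K_0=k_{n-1}k_0$, $E_0=[e_{n-1},e_0]_{D_{n-1,0}}$, $F_0=[f_0,f_{n-1}]_{D_{n-1,0}^{-1}}$. Case $i=1$: $K_0=k_0k_1$, $E_0=[e_0,e_1]_{D_{0,1}}$, $F_0=[f_1,f_0]_{D_{0,1}^{-1}}$; $K_j=k_{j+1}$, $E_j=e_{j+1}$, $F_j=f_{j+1}$ for $j\ne0$.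
   Context: Fix an integer $n\ge 4$ and $\epsilon=(\epsilon_1,\dots,\epsilon_n)\in\{0,1\}^n$. For a sequence $\epsilon^\ast\in\{0,1\}^k$: $\mathbb{I}=\{1,\dots,k\}$, $I=\{0,\dots,k-1\}$ (indices mod $k$, $0$ identified with $k$), $\alpha_i=\delta_i-\delta_{i+1}$, $\langle\alpha_i,\delta_j^\vee\rangle$ the coefficient of $\delta_j$ in $\alpha_i$, $I_{\rm even}=\{i:\epsilon^\ast_i=\epsilon^\ast_{i+1}\}$, $I_{\rm odd}=I\setminus I_{\rm even}$, $[2]=q+q^{-1}$, $q_j=q$ if $\epsilon^\ast_j=0$, $q_j=-q^{-1}$ if $\epsilon^\ast_j=1$. $\mathcal{U}(\epsilon^\ast)$ is the $\mathbb{Q}(q)$-algebra generated by pairwise commuting invertible $\omega_j$ ($j\in\mathbb I$) and $e_i,f_i$ ($i\in I$) with relations $\omega_je_i\omega_j^{-1}=q_j^{\langle\alpha_i,\delta_j^\vee\rangle}e_i$, $\omega_jf_i\omega_j^{-1}=q_j^{-\langle\alpha_i,\delta_j^\vee\rangle}f_i$, $e_if_j-f_je_i=\delta_{ij}(k_i-k_i^{-1})/(q-q^{-1})$ with $k_i=\omega_i\omega_{i+1}^{-1}$, $e_i^2=f_i^2=0$ ($i\in I_{\rm odd}$), commutation of $e_i,e_j$ (and $f_i,f_j$) for non-adjacent $i\ne j$, $e_i^2e_j-(-1)^{\epsilon^\ast_i}[2]e_ie_je_i+e_je_i^2=0$ (and for $f$) for $i\in I_{\rm even}$, $j=i\pm1$,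 and for $i\in I_{\rm odd}$: $e_ie_{i-1}e_ie_{i+1}-e_ie_{i+1}e_ie_{i-1}+e_{i+1}e_ie_{i-1}e_i-e_{i-1}e_ie_{i+1}e_i+(-1)^{\epsilon^\ast_i}[2]e_ie_{i-1}e_{i+1}e_i=0$ (and for $f$). In $\mathcal U(\epsilon)$, $k_ie_jk_i^{-1}=D_{ij}e_j$ with $D_{ij}=q_i^{\langle\alpha_j,\delta_i^\vee\rangle}q_{i+1}^{-\langle\alpha_j,\delta_{i+1}^\vee\rangle}$. For $c\in\mathbb Q(q)$, $[a,b]_c=ab-c\,ba$. The generators of $\mathcal U(\epsilon')$ are denoted $\omega'_l,e'_j,f'_j$, and $k'_j=\omega'_j(\omega'_{j+1})^{-1}$. *)

theory Defs
  imports "HOL-Algebra.QuotRing" "HOL-Computational_Algebra.Polynomial"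
          "HOL-Computational_Algebra.Fraction_Field"
begin

type_synonym Qq = "rat poly fract"

definition qv :: Qq where "qv = Fract [:0, 1:] 1"
definition qbr2 :: Qq where "qbr2 = qv + inverse qv"

(* generators: Om j = omega_j, Omi j = omega_j^-1, Eg i = e_i, Fg i = f_i *)
datatype ugen = Om nat | Omi nat | Eg nat | Fg nat

definition valid_gen :: "nat \<Rightarrow> ugen \<Rightarrow> bool" where
  "valid_gen k g = (case g of Om j \<Rightarrow> 1 \<le> j \<and> j \<le> k | Omi j \<Rightarrow> 1 \<le> j \<and> j \<le> k
                     | Eg i \<Rightarrow> i < k | Fg i \<Rightarrow> i < k)"

(* elements of the free (noncommutative) Q(q)-algebra: coefficient functions on words *)
type_synonym elt = "ugen list \<Rightarrow> Qq"

definition fa_add :: "elt \<Rightarrow> elt \<Rightarrow> elt" where "fa_add a b = (\<lambda>w. a w + b w)"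
definition fa_sub :: "elt \<Rightarrow> elt \<Rightarrow> elt" where "fa_sub a b = (\<lambda>w. a w - b w)"
definition fa_smult :: "Qq \<Rightarrow> elt \<Rightarrow> elt" where "fa_smult c a = (\<lambda>w. c * a w)"
definition fa_mult :: "elt \<Rightarrow> elt \<Rightarrow> elt" where
  "fa_mult a b = (\<lambda>w. \<Sum>i\<le>length w. a (take i w) * b (drop i w))"
definition fa_const :: "Qq \<Rightarrow> elt" where "fa_const c = (\<lambda>w. if w = [] then c else 0)"
definition fa_gen :: "ugen \<Rightarrow> elt" where "fa_gen g = (\<lambda>w. if w = [g] then 1 else 0)"
definition fa_prod :: "elt list \<Rightarrow> elt" where "fa_prod xs = foldr fa_mult xs (fa_const 1)"

definition free_alg :: "nat \<Rightarrow> elt ring" where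
  "free_alg k = \<lparr>carrier = {a. finite {w. a w \<noteq> 0} \<and>
                      (\<forall>w. a w \<noteq> 0 \<longrightarrow> (\<forall>g\<in>set w. valid_gen k g))},
                 monoid.mult = fa_mult, monoid.one = fa_const 1, ring.zero = (\<lambda>w. 0), ring.add = fa_add\<rparr>"

(* eps_star_j for j in I (mod k, 0 identified with k); eps_star given as list, eps_star_j = eps ! (j-1) *)
definition eps_at :: "nat list \<Rightarrow> nat \<Rightarrow> nat" where
  "eps_at eps j = eps ! ((j + length eps - 1) mod length eps)"

definition widx :: "nat list \<Rightarrow> nat \<Rightarrow> nat" where
  "widx eps j = (if j mod length eps = 0 then length eps else j mod length eps)"

definition qj :: "nat list \<Rightarrow> nat \<Rightarrow> Qq" where
  "qj eps j = (if eps_at eps j = 0 then qv else - inverse qv)"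

(* <alpha_i, delta_j^vee> with alpha_i = delta_i - delta_{i+1}, indices mod k *)
definition pairing :: "nat list \<Rightarrow> nat \<Rightarrow> nat \<Rightarrow> int" where
  "pairing eps i j = (let k = length eps in
     (if j mod k = i mod k then 1 else 0) - (if j mod k = Suc i mod k then 1 else 0))"

definition even_idx :: "nat list \<Rightarrow> nat \<Rightarrow> bool" where
  "even_idx eps i = (eps_at eps i = eps_at eps (Suc i))"

definition adjacent :: "nat \<Rightarrow> nat \<Rightarrow> nat \<Rightarrow> bool" where
  "adjacent k i j = (j mod k = Suc i mod k \<or> Suc j mod k = i mod k)"

definition sgn_eps :: "nat list \<Rightarrow> nat \<Rightarrow> Qq" where
  "sgn_eps eps i = (-1) ^ eps_at eps i"

definition om :: "nat list \<Rightarrow> nat \<Rightarrow> elt" where "om eps j = fa_gen (Om (widx eps j))"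
definition omi :: "nat list \<Rightarrow> nat \<Rightarrow> elt" where "omi eps j = fa_gen (Omi (widx eps j))"
definition ee :: "nat list \<Rightarrow> nat \<Rightarrow> elt" where "ee eps i = fa_gen (Eg (i mod length eps))"
definition ff :: "nat list \<Rightarrow> nat \<Rightarrow> elt" where "ff eps i = fa_gen (Fg (i mod length eps))"

definition kk :: "nat list \<Rightarrow> nat \<Rightarrow> elt" where
  "kk eps i = fa_mult (om eps i) (omi eps (Suc i))"
definition kki :: "nat list \<Rightarrow> nat \<Rightarrow> elt" where
  "kki eps i = fa_mult (om eps (Suc i)) (omi eps i)"

definition serre :: "nat list \<Rightarrow> (nat list \<Rightarrow> nat \<Rightarrow> elt) \<Rightarrow> nat \<Rightarrow> nat \<Rightarrow> elt" where
  "serre eps x i j = fa_add (fa_sub (fa_prod [x eps i, x eps i, x eps j])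
        (fa_smult (sgn_eps eps i * qbr2) (fa_prod [x eps i, x eps j, x eps i])))
        (fa_prod [x eps j, x eps i, x eps i])"

definition quartic :: "nat list \<Rightarrow> (nat list \<Rightarrow> nat \<Rightarrow> elt) \<Rightarrow> nat \<Rightarrow> elt" where
  "quartic eps x i = (let k = length eps; m = (i + k - 1) mod k; p = Suc i mod k in
     fa_add (fa_sub (fa_add (fa_sub (fa_prod [x eps i, x eps m, x eps i, x eps p])
                                    (fa_prod [x eps i, x eps p, x eps i, x eps m]))
                            (fa_prod [x eps p, x eps i, x eps m, x eps i]))
                    (fa_prod [x eps m, x eps i, x eps p, x eps i]))
            (fa_smult (sgn_eps eps i * qbr2) (fa_prod [x eps i, x eps m, x eps p, x eps i])))"

definition rels :: "nat list \<Rightarrow> elt set" where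
  "rels eps = (let k = length eps in
     {fa_sub (fa_mult (om eps a) (om eps b)) (fa_mult (om eps b) (om eps a)) | a b.
        1 \<le> a \<and> a \<le> k \<and> 1 \<le> b \<and> b \<le> k}
   \<union> {fa_sub (fa_mult (om eps a) (omi eps a)) (fa_const 1) | a. 1 \<le> a \<and> a \<le> k}
   \<union> {fa_sub (fa_mult (omi eps a) (om eps a)) (fa_const 1) | a. 1 \<le> a \<and> a \<le> k}
   \<union> {fa_sub (fa_prod [om eps j, ee eps i, omi eps j])
             (fa_smult (qj eps j powi pairing eps i j) (ee eps i)) | i j.
        i < k \<and> 1 \<le> j \<and> j \<le> k}
   \<union> {fa_sub (fa_prod [om eps j, ff eps i, omi eps j])
             (fa_smult (qj eps j powi (- pairing eps i j)) (ff eps i)) | i j.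
        i < k \<and> 1 \<le> j \<and> j \<le> k}
   \<union> {fa_sub (fa_sub (fa_mult (ee eps i) (ff eps j)) (fa_mult (ff eps j) (ee eps i)))
             (if i = j then fa_smult (inverse (qv - inverse qv)) (fa_sub (kk eps i) (kki eps i))
              else fa_const 0) | i j. i < k \<and> j < k}
   \<union> {fa_mult (ee eps i) (ee eps i) | i. i < k \<and> \<not> even_idx eps i}
   \<union> {fa_mult (ff eps i) (ff eps i) | i. i < k \<and> \<not> even_idx eps i}
   \<union> {fa_sub (fa_mult (ee eps i) (ee eps j)) (fa_mult (ee eps j) (ee eps i)) | i j.
        i < k \<and> j < k \<and> i \<noteq> j \<and> \<not> adjacent k i j}
   \<union> {fa_sub (fa_mult (ff eps i) (ff eps j)) (fa_mult (ff eps j) (ff eps i)) | i j.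
        i < k \<and> j < k \<and> i \<noteq> j \<and> \<not> adjacent k i j}
   \<union> {serre eps ee i j | i j. i < k \<and> j < k \<and> even_idx eps i \<and> adjacent k i j}
   \<union> {serre eps ff i j | i j. i < k \<and> j < k \<and> even_idx eps i \<and> adjacent k i j}
   \<union> {quartic eps ee i | i. i < k \<and> \<not> even_idx eps i}
   \<union> {quartic eps ff i | i. i < k \<and> \<not> even_idx eps i})"

definition Uq :: "nat list \<Rightarrow> elt set ring" where
  "Uq eps = free_alg (length eps) Quot (Idl\<^bsub>free_alg (length eps)\<^esub> (rels eps))"

definition cls :: "nat list \<Rightarrow> elt \<Rightarrow> elt set" where
  "cls eps x = (Idl\<^bsub>free_alg (length eps)\<^esub> (rels eps)) +>\<^bsub>free_alg (length eps)\<^esub> x"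

definition qcomm :: "Qq \<Rightarrow> elt \<Rightarrow> elt \<Rightarrow> elt" where
  "qcomm c a b = fa_sub (fa_mult a b) (fa_smult c (fa_mult b a))"

definition Dc :: "nat list \<Rightarrow> nat \<Rightarrow> nat \<Rightarrow> Qq" where
  "Dc eps i j = qj eps i powi pairing eps j i * qj eps (Suc i) powi (- pairing eps j (Suc i))"

definition eps_del :: "nat list \<Rightarrow> nat \<Rightarrow> nat list" where
  "eps_del eps r = take (r - 1) eps @ drop r eps"

definition Kimg :: "nat list \<Rightarrow> nat \<Rightarrow> nat \<Rightarrow> elt" where
  "Kimg eps r j = (let n = length eps in
     if r = 1 then (if j = 0 then fa_mult (kk eps 0) (kk eps 1) else kk eps (Suc j))
     else if r = n then (if j = 0 then fa_mult (kk eps (n - 1)) (kk eps 0) else kk eps j)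
     else if j + 2 \<le> r then kk eps j
     else if j + 1 = r then fa_mult (kk eps (r - 1)) (kk eps r)
     else kk eps (Suc j))"

definition Eimg :: "nat list \<Rightarrow> nat \<Rightarrow> nat \<Rightarrow> elt" where
  "Eimg eps r j = (let n = length eps in
     if r = 1 then (if j = 0 then qcomm (Dc eps 0 1) (ee eps 0) (ee eps 1) else ee eps (Suc j))
     else if r = n then (if j = 0 then qcomm (Dc eps (n - 1) 0) (ee eps (n - 1)) (ee eps 0)
                         else ee eps j)
     else if j + 2 \<le> r then ee eps j
     else if j + 1 = r then qcomm (Dc eps (r - 1) r) (ee eps (r - 1)) (ee eps r)
     else ee eps (Suc j))"

definition Fimg :: "nat list \<Rightarrow> nat \<Rightarrow> nat \<Rightarrow> elt" where
  "Fimg eps r j = (let n = length eps in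
     if r = 1 then (if j = 0 then qcomm (inverse (Dc eps 0 1)) (ff eps 1) (ff eps 0)
                    else ff eps (Suc j))
     else if r = n then (if j = 0 then qcomm (inverse (Dc eps (n - 1) 0)) (ff eps 0) (ff eps (n - 1))
                         else ff eps j)
     else if j + 2 \<le> r then ff eps j
     else if j + 1 = r then qcomm (inverse (Dc eps (r - 1) r)) (ff eps r) (ff eps (r - 1))
     else ff eps (Suc j))"

end

theory Submission
  imports Defs
begin

text \<open>
  Number the nodes cyclically from the deleted position \<open>r\<close>: the node \<open>r - 1 + x\<close> of \<open>eps_del eps r\<close>
  corresponds to the node \<open>r + x\<close> of \<open>eps\<close> for \<open>0 < x < n - 1\<close>, and \<open>x = 0\<close> is the merged node with
  \<open>E = a b - t b a\<close>, where \<open>a\<close>, \<open>b\<close> are the generators at \<open>r - 1\<close>, \<open>r\<close> and \<open>t\<close> is the inverse of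
  \<open>qj eps r\<close>. In these coordinates the three cases of the statement coincide. Let \<open>d\<close>, \<open>c\<close> be the
  outer neighbours of \<open>a\<close>, \<open>b\<close>. The only relations that are not linear in \<open>E\<close> are
  \<open>E\<^sup>2 = 0\<close>, the Serre relation of \<open>E\<close> against \<open>c\<close> or \<open>d\<close>, and the quartic relation at \<open>E\<close>. Each of
  them says that \<open>E\<close> commutes up to a scalar with \<open>E\<close>, with a \<open>t\<close>-commutator of \<open>E\<close> and \<open>c\<close>, or with an
  iterated commutator of \<open>d\<close>, \<open>E\<close>, \<open>c\<close>; this holds because \<open>a\<close> and \<open>b\<close> separately commute with that element
  up to scalars, which is a reformulation of the Serre and quartic relations at \<open>a\<close> and \<open>b\<close>. The relations
  against \<open>d\<close> follow from those against \<open>c\<close> by exchanging \<open>(a, c, t)\<close> with \<open>(b, d, 1/t)\<close>, and the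
  \<open>f\<close>-half follows from the \<open>e\<close>-half since \<open>F\<close> is a scalar multiple of \<open>f\<^sub>a f\<^sub>b - t f\<^sub>b f\<^sub>a\<close>.
\<close>

section \<open>The free algebra\<close>

text \<open>\<open>fa_mult\<close> sums over cut positions. Summing over the pairs of factors
  instead turns associativity into a bijection between index sets.\<close>

definition splits :: "'b list \<Rightarrow> ('b list \<times> 'b list) set" where
  "splits w = {(u, v). u @ v = w}"

lemma splits_eq_image: "splits w = (\<lambda>i. (take i w, drop i w)) ` {..length w}"
proof -
  have "(u, v) \<in> (\<lambda>i. (take i (u @ v), drop i (u @ v))) ` {..length (u @ v)}" for u v :: "'b list"
    by (rule image_eqI[where x = "length u"]) auto
  then show ?thesis by (auto simp: splits_def)
qed

lemma finite_splits [simp]: "finite (splits w)"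
  by (simp add: splits_eq_image)

lemma fa_mult_splits: "fa_mult a b w = (\<Sum>(u, v)\<in>splits w. a u * b v)"
proof -
  have "inj_on (\<lambda>i. (take i w, drop i w)) {..length w}"
    by (rule inj_onI) (metis Pair_inject atMost_iff length_take min.absorb2)
  then show ?thesis
    by (simp add: fa_mult_def splits_eq_image sum.reindex)
qed

lemma fa_mult_assoc: "fa_mult (fa_mult a b) c = fa_mult a (fa_mult b c)"
proof
  fix w :: "ugen list"
  let ?L = "Sigma (splits w) (\<lambda>(p, z). splits p)" and ?R = "Sigma (splits w) (\<lambda>(x, p). splits p)"
  have "fa_mult (fa_mult a b) c w = (\<Sum>(p, z)\<in>splits w. \<Sum>(x, y)\<in>splits p. a x * b y * c z)"
    by (simp add: fa_mult_splits sum_distrib_right case_prod_unfold)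
  also have "\<dots> = (\<Sum>((p, z), (x, y))\<in>?L. a x * b y * c z)"
    by (subst sum.Sigma[symmetric]) (auto simp: case_prod_unfold)
  \<comment> \<open>Both index sets describe the factorisations \<open>w = x @ y @ z\<close>,
    bracketed to the left and to the right.\<close>
  also have "\<dots> = (\<Sum>((x, p), (y, z))\<in>?R. a x * b y * c z)"
    by (rule sum.reindex_bij_witness[where i = "\<lambda>((x, p), (y, z)). ((x @ y, z), (x, y))"
          and j = "\<lambda>((p, z), (x, y)). ((x, y @ z), (y, z))"]) (auto simp: splits_def)
  also have "\<dots> = (\<Sum>(x, p)\<in>splits w. \<Sum>(y, z)\<in>splits p. a x * b y * c z)"
    by (subst sum.Sigma[symmetric]) (auto simp: case_prod_unfold)
  also have "\<dots> = fa_mult a (fa_mult b c) w"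
    by (simp add: fa_mult_splits sum_distrib_left case_prod_unfold mult.assoc)
  finally show "fa_mult (fa_mult a b) c w = fa_mult a (fa_mult b c) w" .
qed

lemma fa_mult_const_left: "fa_mult (fa_const c) a = fa_smult c a"
proof
  fix w :: "ugen list"
  have "fa_mult (fa_const c) a w = (\<Sum>(u, v)\<in>{([], w)}. fa_const c u * a v)"
    unfolding fa_mult_splits
    by (rule sum.mono_neutral_right[OF finite_splits])
      (auto simp: splits_def fa_const_def split: if_splits)
  then show "fa_mult (fa_const c) a w = fa_smult c a w"
    by (simp add: fa_const_def fa_smult_def)
qed

lemma fa_mult_const_right: "fa_mult a (fa_const c) = fa_smult c a"
proof
  fix w :: "ugen list"
  have "fa_mult a (fa_const c) w = (\<Sum>(u, v)\<in>{(w, [])}. a u * fa_const c v)"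
    unfolding fa_mult_splits
    by (rule sum.mono_neutral_right[OF finite_splits])
      (auto simp: splits_def fa_const_def split: if_splits)
  then show "fa_mult a (fa_const c) w = fa_smult c a w"
    by (simp add: fa_const_def fa_smult_def mult.commute)
qed

lemma fa_smult_one [simp]: "fa_smult 1 a = a"
  by (simp add: fa_smult_def)

lemma fa_mult_add_left: "fa_mult (fa_add a b) c = fa_add (fa_mult a c) (fa_mult b c)"
  by (simp add: fun_eq_iff fa_mult_def fa_add_def distrib_right sum.distrib)

lemma fa_mult_add_right: "fa_mult a (fa_add b c) = fa_add (fa_mult a b) (fa_mult a c)"
  by (simp add: fun_eq_iff fa_mult_def fa_add_def distrib_left sum.distrib)

section \<open>Finitely supported functions on words as a ring\<close>

abbreviation falg :: "nat \<Rightarrow> elt set" where "falg k \<equiv> carrier (free_alg k)"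

lemma falg_iff: "a \<in> falg k \<longleftrightarrow> finite {w. a w \<noteq> 0} \<and>
    (\<forall>w. a w \<noteq> 0 \<longrightarrow> (\<forall>g\<in>set w. valid_gen k g))"
  by (simp add: free_alg_def)

lemma fa_mult_nonzeroD: "fa_mult a b w \<noteq> 0 \<Longrightarrow> \<exists>u v. w = u @ v \<and> a u \<noteq> 0 \<and> b v \<noteq> 0"
  unfolding fa_mult_splits splits_def by (elim sum.not_neutral_contains_not_neutral) (auto, blast)

lemma falg_mult [simp]:
  assumes "a \<in> falg k" "b \<in> falg k" shows "fa_mult a b \<in> falg k"
proof -
  have "{w. fa_mult a b w \<noteq> 0} \<subseteq> (\<lambda>(u, v). u @ v) ` ({u. a u \<noteq> 0} \<times> {v. b v \<noteq> 0})"
    using fa_mult_nonzeroD by fastforce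
  then have "finite {w. fa_mult a b w \<noteq> 0}"
    by (rule finite_subset) (use assms in \<open>auto simp: falg_iff\<close>)
  with assms show ?thesis
    by (auto simp: falg_iff dest!: fa_mult_nonzeroD)
qed

lemma falg_add [simp]:
  assumes "a \<in> falg k" "b \<in> falg k" shows "fa_add a b \<in> falg k"
proof -
  have "{w. fa_add a b w \<noteq> 0} \<subseteq> {w. a w \<noteq> 0} \<union> {w. b w \<noteq> 0}"
    by (auto simp: fa_add_def)
  then have "finite {w. fa_add a b w \<noteq> 0}"
    by (rule finite_subset) (use assms in \<open>auto simp: falg_iff\<close>)
  with assms show ?thesis
    by (auto simp: falg_iff fa_add_def) (metis add.right_neutral)+
qed

lemma falg_smult [simp]:
  assumes "a \<in> falg k" shows "fa_smult c a \<in> falg k"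
proof -
  have "finite {w. fa_smult c a w \<noteq> 0}"
    by (rule finite_subset[of _ "{w. a w \<noteq> 0}"]) (use assms in \<open>auto simp: falg_iff fa_smult_def\<close>)
  with assms show ?thesis
    by (auto simp: falg_iff fa_smult_def)
qed

lemma fa_sub_eq: "fa_sub a b = fa_add a (fa_smult (- 1) b)"
  by (simp add: fun_eq_iff fa_sub_def fa_add_def fa_smult_def)

lemma falg_sub [simp]: "a \<in> falg k \<Longrightarrow> b \<in> falg k \<Longrightarrow> fa_sub a b \<in> falg k"
  by (simp add: fa_sub_eq)

lemma falg_const [simp]: "fa_const c \<in> falg k"
  by (auto simp: falg_iff fa_const_def)

lemma falg_gen [simp]: "valid_gen k g \<Longrightarrow> fa_gen g \<in> falg k"
  by (auto simp: falg_iff fa_gen_def)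

lemma falg_prod [simp]: "set xs \<subseteq> falg k \<Longrightarrow> fa_prod xs \<in> falg k"
  by (induction xs) (auto simp: fa_prod_def)

lemma free_alg_simps [simp]:
  "a \<otimes>\<^bsub>free_alg k\<^esub> b = fa_mult a b" "a \<oplus>\<^bsub>free_alg k\<^esub> b = fa_add a b"
  "\<one>\<^bsub>free_alg k\<^esub> = fa_const 1" "\<zero>\<^bsub>free_alg k\<^esub> = (\<lambda>w. 0)"
  by (simp_all add: free_alg_def)

lemma fa_zero_eq: "(\<lambda>w. 0) = fa_const 0"
  by (simp add: fa_const_def fun_eq_iff)

lemma ring_free_alg: "ring (free_alg k)"
proof (rule ringI)
  show "abelian_group (free_alg k)"
  proof (rule abelian_groupI)
    fix x assume x: "x \<in> falg k"
    show "\<exists>y\<in>falg k. y \<oplus>\<^bsub>free_alg k\<^esub> x = \<zero>\<^bsub>free_alg k\<^esub>"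
      by (rule bexI[of _ "fa_smult (- 1) x"]) (simp_all add: x falg_smult, simp add: fa_add_def fa_smult_def)
  qed (auto simp: fa_zero_eq, auto simp: fa_add_def fa_const_def algebra_simps)
  show "Group.monoid (free_alg k)"
    by (rule monoidI) (auto simp: fa_mult_assoc fa_mult_const_left fa_mult_const_right)
qed (auto simp: fa_mult_add_left fa_mult_add_right)

section \<open>Commutators, Serre and quartic elements\<close>

text \<open>An algebra over a field, not assumed unital. Its elements form a type of class
  \<open>ring\<close>, so noncommutative identities are checked by \<open>algebra_simps\<close> once
  \<open>sc_simps\<close> has moved the scalars outside.\<close>

locale scaled_ring =
  fixes sc :: "'k::field \<Rightarrow> 'a::ring \<Rightarrow> 'a" (infixr "\<odot>" 75)
  assumes sc_add_right: "c \<odot> (x + y) = c \<odot> x + c \<odot> y"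
    and sc_add_left: "(c + d) \<odot> x = c \<odot> x + d \<odot> x"
    and sc_sc: "c \<odot> d \<odot> x = (c * d) \<odot> x"
    and sc_one: "1 \<odot> x = x"
    and sc_mult_left: "(c \<odot> x) * y = c \<odot> (x * y)"
    and sc_mult_right: "x * (c \<odot> y) = c \<odot> (x * y)"
begin

lemma sc_zero_right [simp]: "c \<odot> 0 = 0"
  using sc_add_right[of c 0 0] by simp

lemma sc_zero_left [simp]: "0 \<odot> x = 0"
  using sc_add_left[of 0 0 x] by simp

lemma sc_minus_right: "c \<odot> (- x) = - (c \<odot> x)"
  using sc_add_right[of c x "- x"] by (simp add: eq_neg_iff_add_eq_0 add.commute)

lemma sc_minus_left: "(- c) \<odot> x = - (c \<odot> x)"
  using sc_add_left[of c "- c" x] by (simp add: eq_neg_iff_add_eq_0 add.commute)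

lemma sc_diff_right: "c \<odot> (x - y) = c \<odot> x - c \<odot> y"
  using sc_add_right[of c x "- y"] by (simp add: sc_minus_right)

lemma sc_diff_left: "(c - d) \<odot> x = c \<odot> x - d \<odot> x"
  using sc_add_left[of c "- d" x] by (simp add: sc_minus_left)

lemma sc_cancel: "c \<noteq> 0 \<Longrightarrow> c \<odot> x = c \<odot> y \<Longrightarrow> x = y"
  by (metis sc_sc sc_one left_inverse)

lemma sc_eq_0_iff: "c \<noteq> 0 \<Longrightarrow> c \<odot> x = 0 \<longleftrightarrow> x = 0"
  by (metis sc_zero_right sc_cancel)

lemmas sc_simps = sc_add_right sc_add_left sc_diff_right sc_diff_left sc_minus_right sc_minus_left
  sc_sc sc_one sc_mult_left sc_mult_right

definition qcom :: "'k \<Rightarrow> 'a \<Rightarrow> 'a \<Rightarrow> 'a" where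
  "qcom t a b = a * b - t \<odot> (b * a)"

definition serre_el :: "'k \<Rightarrow> 'a \<Rightarrow> 'a \<Rightarrow> 'a" where
  "serre_el T x y = x * x * y - T \<odot> (x * y * x) + y * x * x"

definition quartic_el :: "'k \<Rightarrow> 'a \<Rightarrow> 'a \<Rightarrow> 'a \<Rightarrow> 'a" where
  "quartic_el T m x p = x * m * x * p - x * p * x * m + p * x * m * x - m * x * p * x
     + T \<odot> (x * m * p * x)"

text \<open>Passes from the generator of the merged node to its mirror image, in which
  \<open>a\<close> and \<open>b\<close> are exchanged and \<open>t\<close> is inverted.\<close>

lemma qcom_swap: "t \<noteq> 0 \<Longrightarrow> qcom t a b = (- t) \<odot> qcom (inverse t) b a"
  by (simp add: qcom_def sc_simps)

lemma serre_el_scale1: "serre_el T (c \<odot> x) y = (c * c) \<odot> serre_el T x y"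
  by (simp add: serre_el_def sc_simps mult_ac)

lemma serre_el_scale2: "serre_el T x (c \<odot> y) = c \<odot> serre_el T x y"
  by (simp add: serre_el_def sc_simps mult_ac)

lemma quartic_el_scale_mid: "quartic_el T m (c \<odot> x) p = (c * c) \<odot> quartic_el T m x p"
  by (simp add: quartic_el_def sc_simps mult_ac)

lemma quartic_el_scale_left: "quartic_el T (c \<odot> m) x p = c \<odot> quartic_el T m x p"
  by (simp add: quartic_el_def sc_simps mult_ac)

lemma quartic_el_scale_right: "quartic_el T m x (c \<odot> p) = c \<odot> quartic_el T m x p"
  by (simp add: quartic_el_def sc_simps mult_ac)

text \<open>The first four terms change sign when the outer letters are exchanged, and the last one
  is fixed because they commute. This transports quartic relations through the reflection that
  exchanges \<open>a\<close> and \<open>b\<close>.\<close>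

lemma quartic_el_swap: "m * p = p * m \<Longrightarrow> quartic_el (- T) m x p = - quartic_el T p x m"
  by (simp add: quartic_el_def sc_simps algebra_simps)

text \<open>With coefficient \<open>t + inverse t\<close> the Serre element factors into iterated
  commutators: \<open>- t\<close> times it is \<open>b * E - t \<odot> (E * b)\<close> for
  \<open>E = qcom t a b\<close>.\<close>

lemma qcom_left_commute:
  assumes "t \<noteq> 0" "serre_el (t + inverse t) b a = 0"
  shows "b * qcom t a b = t \<odot> (qcom t a b * b)"
proof -
  have "b * qcom t a b - t \<odot> (qcom t a b * b) = (- t) \<odot> serre_el (t + inverse t) b a"
    using assms(1) by (simp add: qcom_def serre_el_def sc_simps algebra_simps)
  then show ?thesis using assms by simp
qed

text \<open>The same factorisation for the Serre element at \<open>a\<close>, which equals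
  \<open>a * E - inverse t \<odot> (E * a)\<close>.\<close>

lemma qcom_right_commute:
  assumes "t \<noteq> 0" "serre_el (t + inverse t) a b = 0"
  shows "a * qcom t a b = inverse t \<odot> (qcom t a b * a)"
proof -
  have "a * qcom t a b - inverse t \<odot> (qcom t a b * a) = serre_el (t + inverse t) a b"
    using assms(1) by (simp add: qcom_def serre_el_def sc_simps algebra_simps)
  then show ?thesis using assms by simp
qed

text \<open>The form in which a commutation up to a scalar rewrites inside right-associated
  products.\<close>

lemma commute_extend: "x * y = c \<odot> (y * x) \<Longrightarrow> x * (y * z) = c \<odot> (y * (x * z))"
  by (metis mult.assoc sc_mult_left)

text \<open>Moving \<open>b\<close> past \<open>X\<close> reduces the commutator of \<open>b\<close>
  with \<open>qcom t X c\<close> to \<open>t\<close> times the commutator of \<open>X\<close> with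
  \<open>qcom (inverse t) b c\<close>.\<close>

lemma qcom_commute:
  assumes "t \<noteq> 0" "b * X = t \<odot> (X * b)" "X * qcom (inverse t) b c = qcom (inverse t) b c * X"
  shows "b * qcom t X c = qcom t X c * b"
proof -
  have "b * qcom t X c - qcom t X c * b
      = t \<odot> (X * qcom (inverse t) b c - qcom (inverse t) b c * X)"
    using assms(1) commute_extend[OF assms(2)]
    by (simp add: qcom_def sc_simps assms(2) algebra_simps)
  with assms(3) show ?thesis by simp
qed

text \<open>
  The commutator of \<open>b\<close> with \<open>R = E c - c E / t = a C - t C a\<close>, computed from either expression, gives
  \<open>t E C - C E / t = t C E - E C / t\<close>, so \<open>(t + 1/t) (E C - C E) = 0\<close>.
\<close>

lemma qcom_qcom_commute:
  assumes t: "t \<noteq> 0" "t + inverse t \<noteq> 0" and ac: "a * c = c * a"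
    and "serre_el (t + inverse t) b a = 0" "serre_el (t + inverse t) b c = 0"
  shows "qcom t a b * qcom (inverse t) b c = qcom (inverse t) b c * qcom t a b"
proof -
  define E where "E = qcom t a b"
  define C where "C = qcom (inverse t) b c"
  have bE: "b * E = t \<odot> (E * b)"
    unfolding E_def by (rule qcom_left_commute) (use assms in auto)
  have bC: "b * C = t \<odot> (C * b)"
    unfolding C_def using qcom_right_commute[of "inverse t" b c] assms by (simp add: add.commute)
  define R where "R = E * c - inverse t \<odot> (c * E)"
  have ac': "a * (c * x) = c * (a * x)" for x
    by (metis ac mult.assoc)
  have R: "R = a * C - t \<odot> (C * a)"
    using t by (simp add: R_def E_def C_def qcom_def sc_simps algebra_simps ac ac')
  have 1: "b * R - R * b = t \<odot> (E * C) - inverse t \<odot> (C * E)"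
    using t commute_extend[OF bE] by (simp add: R_def C_def qcom_def sc_simps algebra_simps bE)
  have 2: "b * R - R * b = t \<odot> (C * E) - inverse t \<odot> (E * C)"
    using t commute_extend[OF bC] by (simp add: R E_def qcom_def sc_simps algebra_simps bC)
  have "(t + inverse t) \<odot> (E * C) = (t + inverse t) \<odot> (C * E)"
    using 1 2 by (simp add: sc_simps algebra_simps)
  from sc_cancel[OF t(2) this] show ?thesis
    by (simp add: E_def C_def)
qed

text \<open>With \<open>W = qcom t E c\<close>, the Serre element of \<open>E\<close> and
  \<open>c\<close> is \<open>E * W - inverse t \<odot> (W * E)\<close>. Moving \<open>a\<close> past
  \<open>W\<close> costs \<open>inverse t\<close> and moving \<open>b\<close> past \<open>W\<close>
  costs nothing, so both terms of \<open>E = a * b - t \<odot> (b * a)\<close> pass \<open>W\<close>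
  at the cost \<open>inverse t\<close>.\<close>

lemma serre_qcom_even:
  assumes t: "t \<noteq> 0" "t + inverse t \<noteq> 0" and ac: "a * c = c * a"
    and "serre_el (t + inverse t) a b = 0" "serre_el (t + inverse t) b a = 0"
      "serre_el (t + inverse t) b c = 0"
  shows "serre_el (t + inverse t) (qcom t a b) c = 0"
proof -
  define E where "E = qcom t a b"
  define W where "W = qcom t E c"
  have aE: "a * E = inverse t \<odot> (E * a)"
    unfolding E_def by (rule qcom_right_commute) (use assms in auto)
  have bW: "b * W = W * b"
    unfolding W_def E_def
    by (rule qcom_commute[OF t(1) qcom_left_commute[OF t(1) assms(5)]
          qcom_qcom_commute[OF t ac assms(5,6)]])
  have ac': "a * (c * x) = c * (a * x)" and bW': "b * (W * x) = W * (b * x)" for x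
    by (metis ac mult.assoc) (metis bW mult.assoc)
  have aW: "a * W = inverse t \<odot> (W * a)"
    using commute_extend[OF aE] by (simp add: W_def qcom_def sc_simps algebra_simps aE ac ac')
  have "E * W = inverse t \<odot> (W * E)"
    using t commute_extend[OF aW] by (simp add: E_def qcom_def sc_simps algebra_simps aW bW bW')
  moreover have "serre_el (t + inverse t) E c = E * W - inverse t \<odot> (W * E)"
    using t by (simp add: W_def qcom_def serre_el_def sc_simps algebra_simps)
  ultimately show ?thesis by (simp add: E_def)
qed

text \<open>Two odd nodes merge into an even one whose parity is opposite to the deleted one, hence
  the sign in front of \<open>t + inverse t\<close>. The quartic relation at \<open>b\<close> says
  exactly that \<open>b\<close> commutes with \<open>W\<close>, and \<open>a * a = 0\<close> makes
  \<open>a\<close> pass \<open>E\<close>, and then \<open>W\<close>, at the cost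
  \<open>- t\<close>.\<close>

lemma serre_qcom_odd:
  assumes t: "t \<noteq> 0" and ac: "a * c = c * a" and aa: "a * a = 0" and bb: "b * b = 0"
    and q: "quartic_el (t + inverse t) a b c = 0"
  shows "serre_el (- (t + inverse t)) (qcom t a b) c = 0"
proof -
  define E where "E = qcom t a b"
  define W where "W = E * c + inverse t \<odot> (c * E)"
  have ac': "a * (c * x) = c * (a * x)" and aa': "a * (a * x) = 0" and bb': "b * (b * x) = 0" for x
    by (metis ac mult.assoc) (metis aa mult.assoc mult_zero_left, metis bb mult.assoc mult_zero_left)
  have "b * W - W * b = quartic_el (t + inverse t) a b c"
    using t by (simp add: W_def E_def qcom_def quartic_el_def sc_simps algebra_simps bb bb' ac ac')
  then have bW: "b * W = W * b" using q by simp
  have aE: "a * E = (- t) \<odot> (E * a)"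
    by (simp add: E_def qcom_def sc_simps algebra_simps aa aa')
  have bW': "b * (W * x) = W * (b * x)" for x
    by (metis bW mult.assoc)
  have aW: "a * W = (- t) \<odot> (W * a)"
    using commute_extend[OF aE] by (simp add: W_def sc_simps algebra_simps aE ac ac')
  have "E * W = (- t) \<odot> (W * E)"
    using t commute_extend[OF aW] by (simp add: E_def qcom_def sc_simps algebra_simps aW bW bW')
  moreover have "serre_el (- (t + inverse t)) E c = E * W + t \<odot> (W * E)"
    using t by (simp add: W_def serre_el_def sc_simps algebra_simps)
  ultimately show ?thesis by (simp add: E_def sc_simps)
qed

text \<open>Here \<open>a\<close> is odd and \<open>b\<close> is even. They pass \<open>E\<close> at
  the costs \<open>- t\<close> and \<open>t\<close>, so \<open>E\<close> passes itself at the cost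
  \<open>- (t * t)\<close>, and \<open>(1 + t * t) \<odot> (E * E) = 0\<close>. The scalar is
  \<open>t * (t + inverse t)\<close>, which can be cancelled.\<close>

lemma qcom_square_zero:
  assumes t: "t \<noteq> 0" "t + inverse t \<noteq> 0" and aa: "a * a = 0"
    and serre: "serre_el (t + inverse t) b a = 0"
  shows "qcom t a b * qcom t a b = 0"
proof -
  define E where "E = qcom t a b"
  have aa': "a * (a * x) = 0" for x
    by (metis aa mult.assoc mult_zero_left)
  have bE: "b * E = t \<odot> (E * b)"
    unfolding E_def by (rule qcom_left_commute) (use assms in auto)
  have aE: "a * E = (- t) \<odot> (E * a)"
    by (simp add: E_def qcom_def sc_simps algebra_simps aa aa')
  have "E * E = (a * b - t \<odot> (b * a)) * E"
    by (simp add: E_def qcom_def)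
  also have "\<dots> = (- (t * t)) \<odot> (E * (a * b - t \<odot> (b * a)))"
    using commute_extend[OF aE] commute_extend[OF bE]
    by (simp add: sc_simps algebra_simps aE bE)
  also have "\<dots> = (- (t * t)) \<odot> (E * E)"
    by (simp add: E_def qcom_def)
  finally have "E * E = - ((t * t) \<odot> (E * E))"
    by (simp add: sc_minus_left)
  then have "(1 + t * t) \<odot> (E * E) = 0"
    by (simp only: sc_add_left sc_one eq_neg_iff_add_eq_0)
  moreover have "1 + t * t = t * (t + inverse t)"
    using t by (simp add: algebra_simps)
  ultimately show ?thesis
    using t sc_eq_0_iff[of "1 + t * t"] by (simp add: E_def)
qed

text \<open>Since \<open>E * E = 0\<close>, the quartic element at \<open>E\<close> collapses to the
  commutator of \<open>E\<close> with \<open>Y\<close>. The quartic relation at the odd node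
  \<open>a\<close> is the commutation of \<open>a\<close> with \<open>X\<close>, and
  \<open>a\<close> commutes with \<open>c\<close>, so \<open>a\<close> commutes with
  \<open>Y\<close>. For the even node \<open>b\<close> this is \<open>qcom_commute\<close>, whose
  remaining commutator vanishes because \<open>C\<close> commutes with both \<open>d\<close> and
  \<open>E\<close>.\<close>

lemma quartic_qcom:
  assumes t: "t \<noteq> 0" "t + inverse t \<noteq> 0" and aa: "a * a = 0"
    and comm: "a * c = c * a" "d * b = b * d" "d * c = c * d"
    and serre: "serre_el (t + inverse t) b a = 0" "serre_el (t + inverse t) b c = 0"
    and quartic: "quartic_el (- (t + inverse t)) d a b = 0"
  shows "quartic_el (- (t + inverse t)) d (qcom t a b) c = 0"
proof -
  define E where "E = qcom t a b"
  define C where "C = qcom (inverse t) b c"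
  \<comment> \<open>This is \<open>qcom (- inverse t) d E\<close>; the sign reflects that
    \<open>a\<close> is odd.\<close>
  define X where "X = d * E + inverse t \<odot> (E * d)"
  define Y where "Y = qcom t X c"
  have EE: "E * E = 0"
    unfolding E_def by (rule qcom_square_zero) (use assms in auto)
  have bE: "b * E = t \<odot> (E * b)"
    unfolding E_def by (rule qcom_left_commute) (use assms in auto)
  have EC: "E * C = C * E"
    unfolding E_def C_def by (rule qcom_qcom_commute) (use assms in auto)
  have comm': "a * (c * x) = c * (a * x)" "d * (b * x) = b * (d * x)" "d * (c * x) = c * (d * x)"
    "a * (a * x) = 0" "E * (E * x) = 0" for x
    by (metis comm(1) mult.assoc, metis comm(2) mult.assoc, metis comm(3) mult.assoc,
        metis aa mult.assoc mult_zero_left, metis EE mult.assoc mult_zero_left)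
  have "a * X - X * a = quartic_el (- (t + inverse t)) d a b"
    using t by (simp add: X_def E_def qcom_def quartic_el_def sc_simps algebra_simps aa comm comm')
  then have aX: "a * X = X * a" using quartic by simp
  have bX: "b * X = t \<odot> (X * b)"
    using commute_extend[OF bE] by (simp add: X_def sc_simps algebra_simps bE comm(2)[symmetric] comm'(2)[symmetric])
  have dC: "d * C = C * d"
    by (simp add: C_def qcom_def sc_simps algebra_simps comm comm')
  have XC: "X * C = C * X"
  proof -
    have "d * (C * x) = C * (d * x)" "E * (C * x) = C * (E * x)" for x
      by (metis dC mult.assoc) (metis EC mult.assoc)
    then show ?thesis by (simp add: X_def sc_simps algebra_simps EC dC)
  qed
  have bY: "b * Y = Y * b"
    unfolding Y_def by (rule qcom_commute[OF t(1) bX XC[unfolded C_def]])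
  have aX': "a * (X * x) = X * (a * x)" and bY': "b * (Y * x) = Y * (b * x)" for x
    by (metis aX mult.assoc) (metis bY mult.assoc)
  have aY: "a * Y = Y * a"
    by (simp add: Y_def qcom_def sc_simps algebra_simps aX aX' comm comm')
  have aY': "a * (Y * x) = Y * (a * x)" for x
    by (metis aY mult.assoc)
  have "E * Y = Y * E"
    by (simp add: E_def qcom_def sc_simps algebra_simps aY aY' bY bY')
  moreover have "quartic_el (- (t + inverse t)) d E c = E * Y - Y * E"
    using t by (simp add: Y_def X_def qcom_def quartic_el_def sc_simps algebra_simps EE comm comm')
  ultimately show ?thesis by (simp add: E_def)
qed

end

section \<open>Merging two nodes\<close>

lemma qv_nonzero [simp]: "qv \<noteq> 0"
  by (simp add: qv_def Zero_fract_def eq_fract)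

lemma qv_square: "qv * qv \<noteq> 1" "qv * qv \<noteq> - 1"
proof -
  have eq: "qv * qv - c = Fract ([:0, 0, 1:] - [:a:]) 1" if "c = Fract [:a:] 1" for c a
    using that by (simp add: qv_def)
  have "1 = Fract [:1:] 1" "- 1 = Fract [:- 1:] (1 :: rat poly)"
    by (simp_all add: One_fract_def flip: one_pCons)
       (simp add: one_pCons)
  from this[THEN eq] have "qv * qv - 1 \<noteq> 0" "qv * qv - (- 1) \<noteq> 0"
    by (simp_all add: Zero_fract_def eq_fract del: diff_minus_eq_add)
  then show "qv * qv \<noteq> 1" "qv * qv \<noteq> - 1" by auto
qed

lemma qbr2_nonzero: "qbr2 \<noteq> 0"
proof
  assume "qbr2 = 0"
  then have "qv * (qv + inverse qv) = 0" by (simp add: qbr2_def)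
  then have "qv * qv = - 1" by (simp add: distrib_left eq_neg_iff_add_eq_0)
  with qv_square show False by simp
qed

lemma qv_diff_nonzero: "qv - inverse qv \<noteq> 0"
proof
  assume "qv - inverse qv = 0"
  then have "qv * (qv - inverse qv) = 0" by simp
  then have "qv * qv = 1" by (simp add: right_diff_distrib)
  with qv_square show False by simp
qed

text \<open>The scalar q_j as a function of the parity alone, so that it applies to renumbered and
  merged parity sequences.\<close>

definition qparam :: "nat \<Rightarrow> Qq" where
  "qparam m = (if m = 0 then qv else - inverse qv)"

lemma qparam_nonzero [simp]: "qparam m \<noteq> 0"
  by (simp add: qparam_def)

text \<open>Writes the coefficient of the Serre and quartic relations as
  \<open>t + inverse t\<close> with t = 1/q_j, so that one computation covers both parities.\<close>

lemma qparam_sum: "m \<in> {0, 1} \<Longrightarrow> inverse (qparam m) + qparam m = (- 1) ^ m * qbr2"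
  by (auto simp: qparam_def qbr2_def)

text \<open>The map x -> -1/x fixes x - 1/x. Hence the bracket of the merged \<open>e\<close> and
  \<open>f\<close> has the same denominator for either deleted parity.\<close>

lemma qparam_diff: "qparam m - inverse (qparam m) = qv - inverse qv"
  by (auto simp: qparam_def)

lemma sign_flip: "l \<in> {0, 1} \<Longrightarrow> m \<in> {0, 1} \<Longrightarrow> l \<noteq> m \<Longrightarrow> (- 1 :: Qq) ^ l * T = - ((- 1) ^ m * T)"
  by auto

lemma adjacent_iff:
  assumes "2 \<le> k" "i < k" "j < k"
  shows "adjacent k i j \<longleftrightarrow> j = Suc i \<or> i = Suc j \<or> (i = 0 \<and> Suc j = k) \<or> (j = 0 \<and> Suc i = k)"
proof -
  have "Suc i mod k = (if Suc i = k then 0 else Suc i)" "Suc j mod k = (if Suc j = k then 0 else Suc j)"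
    using assms by auto
  then show ?thesis using assms by (auto simp: adjacent_def)
qed

lemma mod_cong_periodic:
  assumes "\<And>i. f (i + k) = f (i :: nat)"
  shows "f (i mod k) = f i"
proof -
  have "f (i + m * k) = f i" for m i
  proof (induction m)
    case (Suc m)
    then show ?case using assms[of "i + m * k"] by (simp add: algebra_simps)
  qed simp
  from this[of "i mod k" "i div k"] show ?thesis by simp
qed

text \<open>
  A sequence of period \<open>n - 1\<close>: the entries \<open>n - 1\<close> and \<open>0\<close> of \<open>x\<close> are fused into \<open>m\<close> at index \<open>0\<close>.
\<close>

definition merge_seq :: "nat \<Rightarrow> 'b \<Rightarrow> (nat \<Rightarrow> 'b) \<Rightarrow> nat \<Rightarrow> 'b" where
  "merge_seq n m x j = (if j mod (n - 1) = 0 then m else x (j mod (n - 1)))"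

lemma merge_seq_periodic: "merge_seq n m x (j + (n - 1)) = merge_seq n m x j"
  by (simp add: merge_seq_def)

section \<open>Relations among generators of one kind under merging\<close>

locale q_scaled_ring = scaled_ring sc for sc :: "Qq \<Rightarrow> 'a::ring \<Rightarrow> 'a" (infixr "\<odot>" 75)
begin

text \<open>For a node \<open>c\<close> adjacent to only one half of the merged node: the Serre
  element is linear in its second argument, and \<open>a\<close>, which commutes with
  \<open>c\<close>, can be pulled out on either side.\<close>

lemma serre_el_qcom_right:
  assumes "c * a = a * c" "serre_el T c b = 0"
  shows "serre_el T c (qcom t a b) = 0"
proof -
  have "c * (a * x) = a * (c * x)" for x
    by (metis assms(1) mult.assoc)
  then have "serre_el T c (qcom t a b) = a * serre_el T c b - t \<odot> (serre_el T c b * a)"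
    by (simp add: serre_el_def qcom_def sc_simps algebra_simps assms(1))
  then show ?thesis using assms(2) by simp
qed

text \<open>The merged node is here an outer letter, in which the quartic element is linear;
  \<open>a\<close> commutes with both other letters and can be pulled out.\<close>

lemma quartic_el_qcom_left:
  assumes "x * a = a * x" "p * a = a * p" "quartic_el T b x p = 0"
  shows "quartic_el T (qcom t a b) x p = 0"
proof -
  have "x * (a * y) = a * (x * y)" "p * (a * y) = a * (p * y)" for y
    by (metis assms(1) mult.assoc) (metis assms(2) mult.assoc)
  then have "quartic_el T (qcom t a b) x p = a * quartic_el T b x p - t \<odot> (quartic_el T b x p * a)"
    by (simp add: quartic_el_def qcom_def sc_simps algebra_simps assms(1,2))
  then show ?thesis using assms(3) by simp
qed

lemma quartic_el_qcom_right:
  assumes "x * a = a * x" "m * a = a * m" "quartic_el T m x b = 0"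
  shows "quartic_el T m x (qcom t a b) = 0"
proof -
  have "x * (a * y) = a * (x * y)" "m * (a * y) = a * (m * y)" for y
    by (metis assms(1) mult.assoc) (metis assms(2) mult.assoc)
  then have "quartic_el T m x (qcom t a b) = a * quartic_el T m x b - t \<odot> (quartic_el T m x b * a)"
    by (simp add: quartic_el_def qcom_def sc_simps algebra_simps assms(1,2))
  then show ?thesis using assms(3) by simp
qed

text \<open>The relations among the \<open>e\<^sub>i\<close> alone; those among the \<open>f\<^sub>i\<close> have the same form.\<close>

definition half_rels :: "nat \<Rightarrow> (nat \<Rightarrow> nat) \<Rightarrow> (nat \<Rightarrow> 'a) \<Rightarrow> bool" where
  "half_rels k \<eta> x \<longleftrightarrow>
     (\<forall>i. \<eta> i \<noteq> \<eta> (Suc i) \<longrightarrow> x i * x i = 0) \<and>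
     (\<forall>i j. i mod k \<noteq> j mod k \<longrightarrow> \<not> adjacent k i j \<longrightarrow> x i * x j = x j * x i) \<and>
     (\<forall>i j. \<eta> i = \<eta> (Suc i) \<longrightarrow> adjacent k i j \<longrightarrow> serre_el ((- 1) ^ \<eta> i * qbr2) (x i) (x j) = 0) \<and>
     (\<forall>i. \<eta> i \<noteq> \<eta> (Suc i) \<longrightarrow>
        quartic_el ((- 1) ^ \<eta> i * qbr2) (x (i + k - 1)) (x i) (x (Suc i)) = 0)"

lemma half_relsD:
  assumes "half_rels k \<eta> x"
  shows "\<eta> i \<noteq> \<eta> (Suc i) \<Longrightarrow> x i * x i = 0"
    "i mod k \<noteq> j mod k \<Longrightarrow> \<not> adjacent k i j \<Longrightarrow> x i * x j = x j * x i"
    "\<eta> i = \<eta> (Suc i) \<Longrightarrow> adjacent k i j \<Longrightarrow> serre_el ((- 1) ^ \<eta> i * qbr2) (x i) (x j) = 0"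
    "\<eta> i \<noteq> \<eta> (Suc i) \<Longrightarrow> quartic_el ((- 1) ^ \<eta> i * qbr2) (x (i + k - 1)) (x i) (x (Suc i)) = 0"
  using assms unfolding half_rels_def by blast+

text \<open>\<open>half_rels\<close> quantifies over all naturals, which makes it stable under
  shifts; by periodicity it is enough to check representatives below \<open>k\<close>.\<close>

lemma half_relsI:
  assumes k: "0 < k" and \<eta>: "\<And>i. \<eta> (i + k) = \<eta> i" and x: "\<And>i. x (i + k) = x i"
    and "\<And>i. i < k \<Longrightarrow> \<eta> i \<noteq> \<eta> (Suc i) \<Longrightarrow> x i * x i = 0"
    and "\<And>i j. i < k \<Longrightarrow> j < k \<Longrightarrow> i \<noteq> j \<Longrightarrow> \<not> adjacent k i j \<Longrightarrow> x i * x j = x j * x i"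
    and "\<And>i j. i < k \<Longrightarrow> j < k \<Longrightarrow> \<eta> i = \<eta> (Suc i) \<Longrightarrow> adjacent k i j
            \<Longrightarrow> serre_el ((- 1) ^ \<eta> i * qbr2) (x i) (x j) = 0"
    and "\<And>i. i < k \<Longrightarrow> \<eta> i \<noteq> \<eta> (Suc i)
            \<Longrightarrow> quartic_el ((- 1) ^ \<eta> i * qbr2) (x (i + k - 1)) (x i) (x (Suc i)) = 0"
  shows "half_rels k \<eta> x"
proof -
  have \<eta>': "\<eta> (i mod k) = \<eta> i" and x': "x (i mod k) = x i" for i
    by (rule mod_cong_periodic, rule \<eta>) (rule mod_cong_periodic, rule x)
  have suc: "\<eta> (Suc (i mod k)) = \<eta> (Suc i)" "x (Suc (i mod k)) = x (Suc i)" for i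
    using \<eta>'[of "Suc i"] \<eta>'[of "Suc (i mod k)"] x'[of "Suc i"] x'[of "Suc (i mod k)"]
    by (simp_all add: mod_Suc_eq)
  \<comment> \<open>The predecessor is written with \<open>+ k - 1\<close> so that it wraps round at
    0, where subtraction on naturals would stop.\<close>
  have pred: "x (i mod k + k - 1) = x (i + k - 1)" for i
  proof -
    have "(i mod k + (k - 1)) mod k = (i + (k - 1)) mod k"
      by (simp add: mod_add_left_eq)
    then show ?thesis
      using k x'[of "i mod k + (k - 1)"] x'[of "i + (k - 1)"] by (simp add: Nat.add_diff_assoc)
  qed
  have adj: "adjacent k (i mod k) (j mod k) \<longleftrightarrow> adjacent k i j" for i j
    by (simp add: adjacent_def mod_Suc_eq)
  have less: "i mod k < k" for i using k by simp
  show ?thesis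
    unfolding half_rels_def
  proof (intro conjI allI impI)
    fix i j
    show "x i * x i = 0" if "\<eta> i \<noteq> \<eta> (Suc i)"
      using assms(4)[of "i mod k"] that by (simp add: less suc \<eta>' x')
    show "x i * x j = x j * x i" if "i mod k \<noteq> j mod k" "\<not> adjacent k i j"
      using assms(5)[of "i mod k" "j mod k"] that by (simp add: less adj x')
    show "serre_el ((- 1) ^ \<eta> i * qbr2) (x i) (x j) = 0" if "\<eta> i = \<eta> (Suc i)" "adjacent k i j"
      using assms(6)[of "i mod k" "j mod k"] that by (simp add: less suc adj \<eta>' x')
    show "quartic_el ((- 1) ^ \<eta> i * qbr2) (x (i + k - 1)) (x i) (x (Suc i)) = 0" if "\<eta> i \<noteq> \<eta> (Suc i)"
      using assms(7)[of "i mod k"] that by (simp only: less suc pred \<eta>' x' simp_thms)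
  qed
qed

text \<open>The scalar \<open>l\<close> lets one statement serve both halves: it is 1 for the
  \<open>e\<close> half and \<open>- inverse t\<close> for the \<open>f\<close> half. Relations away
  from index 0 are inherited. At index 0 the parities of \<open>a\<close> and \<open>b\<close>
  select a commutator lemma, and each assertion about \<open>d\<close> is the mirror image of one
  about \<open>c\<close>. For \<open>n = 4\<close> homogeneity leaves no odd node after merging, so
  no quartic relation arises.\<close>

lemma merge_half_rels:
  assumes n: "4 \<le> n" and \<eta>: "\<And>i. \<eta> (i + n) = \<eta> i" and x: "\<And>i. x (i + n) = x i"
    and rng: "\<And>i. \<eta> i \<in> {0, 1}"
    and homog: "n = 4 \<Longrightarrow> \<eta> 1 = \<eta> 2 \<and> \<eta> 2 = \<eta> 3"
    and R: "half_rels n \<eta> x"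
    and E: "E = l \<odot> qcom (inverse (qparam (\<eta> 0))) (x (n - 1)) (x 0)"
  shows "half_rels (n - 1) (merge_seq n (\<eta> (n - 1)) \<eta>) (merge_seq n E x)"
proof -
  define t where "t = inverse (qparam (\<eta> 0))"
  define T where "T = t + inverse t"
  define a where "a = x (n - 1)"
  define b where "b = x 0"
  define c where "c = x 1"
  define d where "d = x (n - 2)"
  have t: "t \<noteq> 0" by (simp add: t_def)
  have T: "T = (- 1) ^ \<eta> 0 * qbr2"
    using qparam_sum[OF rng[of 0]] by (simp add: T_def t_def)
  then have T0: "T \<noteq> 0" by (simp add: qbr2_nonzero)
  have u: "inverse t \<noteq> 0" "inverse t + inverse (inverse t) = T"
    using t by (simp_all add: T_def add.commute)
  \<comment> \<open>All coefficients are measured against the deleted parity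
    \<open>\<eta> 0\<close>, which fixes the sign of \<open>T\<close>.\<close>
  have sgn: "(- 1) ^ \<eta> i * qbr2 = (if \<eta> i = \<eta> 0 then T else - T)" for i
    using sign_flip[OF rng[of i] rng[of 0]] by (auto simp: T)
  have E1: "E = l \<odot> qcom t a b"
    by (simp add: E t_def a_def b_def)
  have E2: "E = (- (l * t)) \<odot> qcom (inverse t) b a"
    using qcom_swap[OF t, of a b] by (simp add: E1 sc_sc)
  have sucn: "\<eta> n = \<eta> 0" "x n = x 0" "Suc (n - 2) = n - 1"
    using \<eta>[of 0] x[of 0] n by simp_all
  have adj: "adjacent n i j \<longleftrightarrow> j = Suc i \<or> i = Suc j \<or> (i = 0 \<and> Suc j = n) \<or> (j = 0 \<and> Suc i = n)"
    if "i < n" "j < n" for i j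
    using that n by (intro adjacent_iff) auto
  have comm: "x i * x j = x j * x i" if "i < n" "j < n" "i \<noteq> j" "\<not> adjacent n i j" for i j
    using half_relsD(2)[OF R, of i j] that by simp
  have serre: "serre_el (if \<eta> i = \<eta> 0 then T else - T) (x i) (x j) = 0"
    if "\<eta> i = \<eta> (Suc i)" "adjacent n i j" for i j
    using half_relsD(3)[OF R that] by (simp add: sgn)
  have quartic: "quartic_el (if \<eta> i = \<eta> 0 then T else - T) (x (i - 1)) (x i) (x (Suc i)) = 0"
    if "\<eta> i \<noteq> \<eta> (Suc i)" "0 < i" for i
  proof -
    have "x (i + n - 1) = x (i - 1)"
      using x[of "i - 1"] that(2) by simp
    then show ?thesis using half_relsD(4)[OF R that(1)] by (simp add: sgn)
  qed
  have ac: "a * c = c * a" unfolding a_def c_def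
    by (rule comm) (use n in \<open>auto simp: adj\<close>)
  have bd: "b * d = d * b" unfolding b_def d_def
    by (rule comm) (use n in \<open>auto simp: adj\<close>)
  \<comment> \<open>For \<open>n = 4\<close> these two nodes are adjacent.\<close>
  have dc: "d * c = c * d" if "5 \<le> n" unfolding c_def d_def
    by (rule comm) (use that in \<open>auto simp: adj\<close>)
  have xa: "x i * a = a * x i" if "0 < i" "i < n - 2" for i unfolding a_def
    by (rule comm) (use that in \<open>auto simp: adj\<close>)
  have xb: "x i * b = b * x i" if "1 < i" "i < n - 1" for i unfolding b_def
    by (rule comm) (use that in \<open>auto simp: adj\<close>)
  have b_even: "serre_el T b a = 0" "serre_el T b c = 0" if "\<eta> 0 = \<eta> 1"
    using serre[of 0 "n - 1"] serre[of 0 1] that n by (simp_all add: adj a_def b_def c_def)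
  have a_even: "serre_el T a b = 0" "serre_el T a d = 0" if "\<eta> (n - 1) = \<eta> 0"
    using serre[of "n - 1" 0] serre[of "n - 1" "n - 2"] that n
    by (simp_all add: adj sucn a_def b_def d_def)
  have b_odd: "b * b = 0" "quartic_el T a b c = 0" if "\<eta> 0 \<noteq> \<eta> 1"
    using half_relsD(1,4)[OF R, of 0] that n by (simp_all add: sgn a_def b_def c_def)
  \<comment> \<open>The quartic relation at \<open>b\<close> carries the parity
    \<open>\<eta> 0\<close>, hence \<open>T\<close>. At \<open>a\<close> it carries
    \<open>\<eta> (n - 1)\<close>, which differs from \<open>\<eta> 0\<close> when \<open>a\<close>
    is odd, hence \<open>- T\<close>.\<close>
  have a_odd: "a * a = 0" "quartic_el (- T) d a b = 0" if "\<eta> (n - 1) \<noteq> \<eta> 0"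
    using half_relsD(1)[OF R, of "n - 1"] quartic[of "n - 1"] that n
    by (simp_all add: sucn a_def b_def d_def numeral_2_eq_2)
  define h where "h = merge_seq n (\<eta> (n - 1)) \<eta>"
  define y where "y = merge_seq n E x"
  have x0: "y 0 = E" and \<eta>0: "h 0 = \<eta> (n - 1)"
    by (simp_all add: h_def y_def merge_seq_def)
  have x1: "y i = x i" if "0 < i" "i < n - 1" for i
    using that by (simp add: y_def merge_seq_def)
  have \<eta>1: "h i = \<eta> i" if "0 < i" "i \<le> n - 1" for i
    using that by (cases "i = n - 1") (simp_all add: h_def y_def merge_seq_def)
  have "half_rels (n - 1) h y"
  proof (rule half_relsI)
    fix i assume i: "i < n - 1" and odd: "h i \<noteq> h (Suc i)"
    show "y i * y i = 0"
    proof (cases "i = 0")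
      case True
      then have "\<eta> (n - 1) \<noteq> \<eta> 1" using odd \<eta>0 \<eta>1[of 1] n by simp
      \<comment> \<open>There are only two parities, so an odd merged node comes from exactly one
        odd node among \<open>a\<close> and \<open>b\<close>.\<close>
      then consider "\<eta> 0 = \<eta> 1" "\<eta> (n - 1) \<noteq> \<eta> 0" | "\<eta> 0 \<noteq> \<eta> 1" "\<eta> (n - 1) = \<eta> 0"
        using rng[of 0] rng[of 1] rng[of "n - 1"] by auto
      then show ?thesis
      proof cases
        case 1
        then have "qcom t a b * qcom t a b = 0"
          using t T0 a_odd b_even by (intro qcom_square_zero) (simp_all add: T_def)
        then show ?thesis using True by (simp add: x0 E1 sc_simps)
      next
        case 2
        then have "qcom (inverse t) b a * qcom (inverse t) b a = 0"
          using qcom_square_zero[of "inverse t" b a, unfolded u(2)] u T0 b_odd a_even by simp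
        then show ?thesis using True by (simp add: x0 E2 sc_simps)
      qed
    next
      case False
      with odd i have "\<eta> i \<noteq> \<eta> (Suc i)" using \<eta>1[of i] \<eta>1[of "Suc i"] by simp
      then show ?thesis using half_relsD(1)[OF R] False i by (simp add: x1)
    qed
  next
    \<comment> \<open>Such a node is adjacent to neither \<open>a\<close> nor
      \<open>b\<close>.\<close>
    have E_comm: "x j * E = E * x j" if "1 < j" "j < n - 2" for j
    proof -
      have j: "x j * a = a * x j" "x j * b = b * x j"
        using that xa[of j] xb[of j] by simp_all
      then have "x j * (a * y) = a * (x j * y)" "x j * (b * y) = b * (x j * y)" for y
        by (metis mult.assoc)+
      with j show ?thesis by (simp add: E1 qcom_def sc_simps algebra_simps)
    qed
    fix i j assume ij: "i < n - 1" "j < n - 1" "i \<noteq> j" "\<not> adjacent (n - 1) i j"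
    then have nadj: "\<not> (j = Suc i \<or> i = Suc j \<or> (i = 0 \<and> Suc j = n - 1) \<or> (j = 0 \<and> Suc i = n - 1))"
      using n by (subst (asm) adjacent_iff) auto
    consider "i = 0" "1 < j" "j < n - 2" | "j = 0" "1 < i" "i < n - 2" | "0 < i" "0 < j"
      using ij nadj by (cases "i = 0"; cases "j = 0") force+
    then show "y i * y j = y j * y i"
    proof cases
      case 3
      then show ?thesis using ij nadj comm[of i j] by (simp add: x1 adj)
    qed (simp_all add: x0 x1 E_comm)
  next
    fix i j assume ij: "i < n - 1" "j < n - 1" and even: "h i = h (Suc i)"
      and adj': "adjacent (n - 1) i j"
    then have ij_adj: "j = Suc i \<or> i = Suc j \<or> (i = 0 \<and> Suc j = n - 1) \<or> (j = 0 \<and> Suc i = n - 1)"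
      using n by (subst (asm) adjacent_iff) auto
    show "serre_el ((- 1) ^ h i * qbr2) (y i) (y j) = 0"
    proof (cases "i = 0")
      case i: True
      then have eq: "\<eta> (n - 1) = \<eta> 1" using even \<eta>0 \<eta>1[of 1] n by simp
      have j: "j = 1 \<or> j = n - 2" using i ij_adj by auto
      \<comment> \<open>By \<open>eq\<close>, the nodes \<open>a\<close> and \<open>b\<close> are
        both even if \<open>\<eta> 1 = \<eta> 0\<close>, and both odd otherwise.\<close>
      have Ec: "serre_el (if \<eta> 1 = \<eta> 0 then T else - T) (qcom t a b) c = 0"
      proof (cases "\<eta> 1 = \<eta> 0")
        case True
        then show ?thesis
          using serre_qcom_even[of t a c b] t T0 ac a_even b_even eq by (simp add: T_def)
      next
        case False
        then show ?thesis
          using serre_qcom_odd[of t a c b] t ac a_odd b_odd eq by (simp add: T_def)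
      qed
      have Ed: "serre_el (if \<eta> 1 = \<eta> 0 then T else - T) (qcom (inverse t) b a) d = 0"
      proof (cases "\<eta> 1 = \<eta> 0")
        case True
        then show ?thesis
          using serre_qcom_even[of "inverse t" b d a, unfolded u(2)] u T0 bd a_even b_even eq by simp
      next
        case False
        \<comment> \<open>The mirrored lemma expects coefficient \<open>T\<close> and the outer
          letters in reversed order, while the relation at \<open>a\<close> carries
          \<open>- T\<close>; the swap adjusts both.\<close>
        have "quartic_el T b a d = 0"
        proof -
          have "quartic_el (- T) d a b = - quartic_el T b a d"
            using bd by (intro quartic_el_swap) simp
          then show ?thesis using a_odd False eq by simp
        qed
        then show ?thesis
          using serre_qcom_odd[of "inverse t" b d a, unfolded u(2)] u bd a_odd b_odd eq False by simp
      qed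
      have "serre_el (if \<eta> 1 = \<eta> 0 then T else - T) E c = 0"
        unfolding E1 serre_el_scale1 Ec by simp
      moreover have "serre_el (if \<eta> 1 = \<eta> 0 then T else - T) E d = 0"
        unfolding E2 serre_el_scale1 Ed by simp
      ultimately have "serre_el (if \<eta> 1 = \<eta> 0 then T else - T) E (x j) = 0"
        using j by (auto simp: c_def d_def)
      moreover have "y i = E" "y j = x j"
        using i j n x0 x1[of j] by auto
      moreover have "(- 1) ^ h i * qbr2 = (if \<eta> 1 = \<eta> 0 then T else - T)"
        using \<eta>0 sgn[of 1] by (simp only: i eq)
      ultimately show ?thesis by (simp only:)
    next
      case False
      then have ev: "\<eta> i = \<eta> (Suc i)" and i\<eta>: "h i = \<eta> i" and xi: "y i = x i"
        using even ij \<eta>1[of i] \<eta>1[of "Suc i"] x1 by simp_all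
      show ?thesis
      proof (cases "j = 0")
        case True
        \<comment> \<open>The node 1 is adjacent to \<open>b\<close> only and the node
          \<open>n - 2\<close> to \<open>a\<close> only; the other factor of \<open>E\<close>
          commutes with it. The second case uses the mirrored form of \<open>E\<close>.\<close>
        then consider "i = 1" | "i = n - 2" using ij_adj by auto
        then have "serre_el (if \<eta> i = \<eta> 0 then T else - T) (x i) E = 0"
        proof cases
          case 1
          then have "serre_el (if \<eta> i = \<eta> 0 then T else - T) (x i) b = 0"
            using serre[OF ev, of 0] n by (simp add: adj b_def)
          then show ?thesis
            using serre_el_qcom_right[of "x i" a] 1 n xa[of i] by (simp add: E1 serre_el_scale2)
        next
          case 2
          then have "serre_el (if \<eta> i = \<eta> 0 then T else - T) (x i) a = 0"
            using serre[OF ev, of "n - 1"] n sucn(3) by (simp add: adj a_def)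
          then show ?thesis
            using serre_el_qcom_right[of "x i" b] 2 n xb[of i] by (simp add: E2 serre_el_scale2)
        qed
        then show ?thesis using True by (simp add: x0 i\<eta> xi sgn)
      next
        case j: False
        have "adjacent n i j" using ij ij_adj False j by (simp add: adj)
        then show ?thesis using serre[OF ev] j ij False by (simp add: x1 i\<eta> sgn)
      qed
    qed
  next
    fix i assume i: "i < n - 1" and odd: "h i \<noteq> h (Suc i)"
    have n5: "5 \<le> n"
    proof (rule ccontr)
      assume "\<not> 5 \<le> n"
      then have n4: "n = 4" using n by simp
      then have h: "h 0 = \<eta> 1" "h 1 = \<eta> 1" "h 2 = \<eta> 1" "h 3 = \<eta> 1"
        using homog[OF n4] \<eta>0 \<eta>1[of 1] \<eta>1[of 2] \<eta>1[of 3] by simp_all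
      have "h (Suc i) = h i"
      proof -
        have "i = 0 \<or> i = 1 \<or> i = 2" using i n4 by auto
        then have "(i = 0 \<and> Suc i = 1) \<or> (i = 1 \<and> Suc i = 2) \<or> (i = 2 \<and> Suc i = 3)" by auto
        then show ?thesis using h by (elim disjE conjE) (simp_all only:)
      qed
      with odd show False by simp
    qed
    show "quartic_el ((- 1) ^ h i * qbr2) (y (i + (n - 1) - 1)) (y i) (y (Suc i)) = 0"
    proof (cases "i = 0")
      case True
      then have "\<eta> (n - 1) \<noteq> \<eta> 1" using odd \<eta>0 \<eta>1[of 1] n by simp
      then consider "\<eta> 0 = \<eta> 1" "\<eta> (n - 1) \<noteq> \<eta> 0" | "\<eta> 0 \<noteq> \<eta> 1" "\<eta> (n - 1) = \<eta> 0"
        using rng[of 0] rng[of 1] rng[of "n - 1"] by auto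
      then have "quartic_el (if \<eta> (n - 1) = \<eta> 0 then T else - T) d E c = 0"
      proof cases
        case 1
        then have "quartic_el (- T) d (qcom t a b) c = 0"
          using quartic_qcom[of t a c d b] t T0 ac bd dc[OF n5] a_odd b_even by (simp add: T_def)
        then show ?thesis using 1 by (simp add: E1 quartic_el_scale_mid)
      next
        case 2
        \<comment> \<open>The reflection yields the quartic element with outer letters
          \<open>c\<close>, \<open>d\<close> in this order, so the swap is applied once to the
          hypothesis and once to the conclusion.\<close>
        have "quartic_el (- T) c b a = - quartic_el T a b c"
          using ac by (intro quartic_el_swap) simp
        then have "quartic_el (- T) c (qcom (inverse t) b a) d = 0"
          using quartic_qcom[of "inverse t" b d c a, unfolded u(2)] u T0 ac bd dc[OF n5] b_odd a_even 2 by simp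
        moreover have "quartic_el (- T) c (qcom (inverse t) b a) d = - quartic_el T d (qcom (inverse t) b a) c"
          using dc[OF n5] by (intro quartic_el_swap) simp
        ultimately show ?thesis using 2 by (simp add: E2 quartic_el_scale_mid)
      qed
      moreover have "y (i + (n - 1) - 1) = d"
        using True n x1[of "n - 2"] by (simp add: d_def numeral_2_eq_2)
      ultimately show ?thesis using True n by (simp add: \<eta>0 x0 x1 c_def sgn)
    next
      case False
      then have od: "\<eta> i \<noteq> \<eta> (Suc i)" and i\<eta>: "h i = \<eta> i" and xi: "y i = x i"
        using odd i \<eta>1[of i] \<eta>1[of "Suc i"] x1 by simp_all
      have pred: "y (i + (n - 1) - 1) = y (i - 1)"
        using merge_seq_periodic[of n E x "i - 1"] False by (simp add: y_def)
      have "quartic_el (if \<eta> i = \<eta> 0 then T else - T) (y (i - 1)) (x i) (y (Suc i)) = 0"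
      \<comment> \<open>The merged node is the left neighbour of \<open>i = 1\<close> and the right
        neighbour of \<open>i = n - 2\<close>. As \<open>n\<close> is at least 5, the far half of
        the merged node commutes with the other two letters in each case.\<close>
      proof (cases "i = 1")
        case True
        then have "quartic_el (if \<eta> i = \<eta> 0 then T else - T) b (x i) (x (Suc i)) = 0"
          using quartic[OF od] by (simp add: b_def)
        then have "quartic_el (if \<eta> i = \<eta> 0 then T else - T) E (x i) (x (Suc i)) = 0"
          using quartic_el_qcom_left[of "x i" a "x (Suc i)"] True n5 xa[of i] xa[of "Suc i"]
          by (simp add: E1 quartic_el_scale_left)
        then show ?thesis using True n5 by (simp add: x0 x1)
      next
        case i1: False
        show ?thesis
        proof (cases "i = n - 2")
          case True
          then have "Suc i = n - 1" using n5 by simp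
          then have xs: "x (Suc i) = a" "y (Suc i) = E" by (simp_all add: a_def y_def merge_seq_def)
          have "quartic_el (if \<eta> i = \<eta> 0 then T else - T) (x (i - 1)) (x i) a = 0"
            using quartic[OF od] False xs by simp
          then have "quartic_el (if \<eta> i = \<eta> 0 then T else - T) (x (i - 1)) (x i) E = 0"
            using quartic_el_qcom_right[of "x i" b "x (i - 1)"] True n5 xb[of i] xb[of "i - 1"]
            by (simp add: E2 quartic_el_scale_right)
          then show ?thesis using True n5 xs by (simp add: x1)
        next
          case i2: False
          then show ?thesis using quartic[OF od] i False i1 by (simp add: x1)
        qed
      qed
      then show ?thesis by (simp only: pred i\<eta> xi sgn)
    qed
  next
    show "0 < n - 1" using n by simp
    show "h (i + (n - 1)) = h i" "y (i + (n - 1)) = y i" for i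
      by (simp_all only: h_def y_def merge_seq_periodic)
  qed
  then show ?thesis by (simp only: h_def y_def)
qed

end

section \<open>Weights, the bracket of \<open>e\<close> with \<open>f\<close>, and the full set of
  relations\<close>

definition pair :: "nat \<Rightarrow> nat \<Rightarrow> nat \<Rightarrow> int" where
  "pair k i j = (if j mod k = i mod k then 1 else 0) - (if j mod k = Suc i mod k then 1 else 0)"

lemma pair_mod [simp]: "pair k (i mod k) j = pair k i j" "pair k i (j mod k) = pair k i j"
  by (simp_all add: pair_def mod_Suc_eq)

lemma pair_less:
  "i < k \<Longrightarrow> j < k \<Longrightarrow>
    pair k i j = (if j = i then 1 else 0) - (if j = (if Suc i = k then 0 else Suc i) then 1 else 0)"
  by (simp add: pair_def)

context q_scaled_ring
begin

text \<open>Multiplying the conjugation relation by \<open>w\<close> on the right cancels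
  \<open>w'\<close>; only the identity behaviour of \<open>Z\<close> on \<open>x\<close> enters, not
  a unit of the ring.\<close>

lemma weight_commute:
  assumes "x * Z = x" "w' * w = Z" "w * x * w' = c \<odot> x"
  shows "w * x = c \<odot> (x * w)"
proof -
  have "w * x = w * x * (w' * w)"
    by (simp add: assms(1,2) mult.assoc)
  also have "\<dots> = (w * x * w') * w"
    by (simp add: mult.assoc)
  finally show ?thesis
    by (simp add: assms(3) sc_mult_left)
qed

lemma inverse_weight_commute:
  assumes "c \<noteq> 0" "Z * x = x" "w' * w = Z" "w * x * w' = c \<odot> x"
  shows "w' * x = inverse c \<odot> (x * w')"
proof -
  have "x * w' = (w' * w) * (x * w')"
    using assms(2,3) by (simp flip: mult.assoc)
  also have "\<dots> = w' * (w * x * w')"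
    by (simp add: mult.assoc)
  also have "\<dots> = c \<odot> (w' * x)"
    by (simp add: assms(4) sc_mult_right)
  finally show ?thesis
    using assms(1) by (simp add: sc_sc sc_one)
qed

lemma mult_weight_commute:
  assumes "v * x = c \<odot> (x * v)" "w * x = d \<odot> (x * w)"
  shows "v * w * x = (c * d) \<odot> (x * (v * w))"
proof -
  have "v * w * x = d \<odot> (v * x * w)"
    by (simp add: assms(2) mult.assoc sc_mult_right)
  then show ?thesis
    by (simp add: assms(1) sc_simps mult.assoc mult.commute)
qed

text \<open>Bracketing \<open>E\<close> with \<open>fa\<close> alone leaves a multiple of
  \<open>b * kai\<close>, and with \<open>fb\<close> alone a multiple of \<open>a * kb\<close>.
  Bracketing with the commutator of \<open>fb\<close> and \<open>fa\<close> therefore reduces to the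
  brackets of \<open>a\<close> with \<open>fa\<close> and of \<open>b\<close> with
  \<open>fb\<close>, each times one weight.\<close>

lemma qcom_bracket:
  assumes t: "t \<noteq> 0" and u: "u = inverse t"
    and aa: "a * fa = fa * a + \<kappa> \<odot> (ka - kai)" and bb: "b * fb = fb * b + \<kappa> \<odot> (kb - kbi)"
    and ab: "a * fb = fb * a" and ba: "b * fa = fa * b"
    and k: "ka * b = t \<odot> (b * ka)" "kai * b = u \<odot> (b * kai)"
      "kb * a = t \<odot> (a * kb)" "kbi * a = u \<odot> (a * kbi)"
      "kb * fa = u \<odot> (fa * kb)" "kai * fb = t \<odot> (fb * kai)" "kai * kb = kb * kai"
  shows "qcom t a b * qcom u fb fa - qcom u fb fa * qcom t a b
    = (\<kappa> * \<kappa> * (u - t)) \<odot> (ka * kb - kbi * kai)"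
proof -
  define E where "E = qcom t a b"
  have tu: "t * u = 1" "u * t = 1" "t * (u * z) = z" "u * (t * z) = z" for z
    using t by (simp_all add: u)
  have "E * fa = a * (b * fa) - t \<odot> (b * (a * fa))"
    by (simp add: E_def qcom_def sc_simps algebra_simps)
  also have "\<dots> = (a * fa) * b - t \<odot> (b * (a * fa))"
    by (simp add: ba mult.assoc)
  also have "\<dots> = fa * E + (\<kappa> * (t - u)) \<odot> (b * kai)"
  proof -
    have "b * (fa * a) = fa * (b * a)"
      by (simp add: ba flip: mult.assoc)
    then show ?thesis
      unfolding aa by (simp add: E_def qcom_def sc_simps algebra_simps k)
  qed
  finally have Ea: "E * fa = fa * E + (\<kappa> * (t - u)) \<odot> (b * kai)" .
  have "E * fb = a * (b * fb) - t \<odot> (b * (a * fb))"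
    by (simp add: E_def qcom_def sc_simps algebra_simps)
  also have "\<dots> = a * (b * fb) - t \<odot> ((b * fb) * a)"
    by (simp add: ab mult.assoc)
  also have "\<dots> = fb * E + (\<kappa> * (1 - t * t)) \<odot> (a * kb)"
  proof -
    have "a * (fb * b) = fb * (a * b)"
      by (simp add: ab flip: mult.assoc)
    then show ?thesis
      unfolding bb by (simp add: E_def qcom_def sc_simps algebra_simps k tu)
  qed
  finally have Eb: "E * fb = fb * E + (\<kappa> * (1 - t * t)) \<odot> (a * kb)" .
  have "E * qcom u fb fa - qcom u fb fa * E
      = (E * fb) * fa - u \<odot> ((E * fa) * fb) - qcom u fb fa * E"
    by (simp add: qcom_def sc_simps algebra_simps)
  also have "\<dots> = fb * (E * fa) + (\<kappa> * (1 - t * t)) \<odot> (a * (kb * fa)) - u \<odot> (fa * (E * fb))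
      - (u * (\<kappa> * (t - u))) \<odot> (b * (kai * fb)) - qcom u fb fa * E"
  proof -
    have "E * (fa * z) = fa * (E * z) + (\<kappa> * (t - u)) \<odot> (b * (kai * z))"
      "E * (fb * z) = fb * (E * z) + (\<kappa> * (1 - t * t)) \<odot> (a * (kb * z))" for z
      by (simp_all add: Ea Eb sc_mult_left distrib_right mult.assoc flip: mult.assoc[of E])
    then show ?thesis
      by (simp add: Ea Eb sc_mult_left sc_add_right sc_diff_right sc_sc mult.assoc distrib_right)
  qed
  also have "\<dots> = (\<kappa> * (t - u)) \<odot> (fb * b * kai) + (\<kappa> * (1 - t * t) * u) \<odot> ((a * fa) * kb)
      - (u * \<kappa> * (1 - t * t)) \<odot> (fa * a * kb) - (u * \<kappa> * (t - u) * t) \<odot> ((b * fb) * kai)"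
    unfolding Ea Eb k by (simp add: qcom_def sc_add_right sc_diff_right sc_mult_left sc_mult_right sc_sc
        mult.assoc distrib_left left_diff_distrib)
  also have "\<kappa> * (1 - t * t) * u = \<kappa> * (u - t)"
    by (simp add: algebra_simps tu)
  also have "u * \<kappa> * (1 - t * t) = \<kappa> * (u - t)"
    by (simp add: algebra_simps tu)
  also have "u * \<kappa> * (t - u) * t = \<kappa> * (t - u)"
    by (simp add: algebra_simps tu)
  \<comment> \<open>The mixed terms \<open>kb * kai\<close> and \<open>kai * kb\<close> enter with
    opposite signs and cancel.\<close>
  finally show ?thesis
    unfolding aa bb E_def by (simp add: sc_simps algebra_simps k(7))
qed

text \<open>
  \<open>Z\<close> stands for the unit element, but \<open>Z = 1\<close> is not required: below, \<open>Z\<close> is the central idempotent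
  that cuts one factor out of a product of algebras.
\<close>

definition full_rels :: "nat \<Rightarrow> (nat \<Rightarrow> nat) \<Rightarrow> 'a \<Rightarrow> (nat \<Rightarrow> 'a) \<Rightarrow> (nat \<Rightarrow> 'a) \<Rightarrow> (nat \<Rightarrow> 'a)
    \<Rightarrow> (nat \<Rightarrow> 'a) \<Rightarrow> bool" where
  "full_rels k \<eta> Z W Wi e f \<longleftrightarrow>
     (\<forall>i j. W i * W j = W j * W i) \<and> (\<forall>i. W i * Wi i = Z \<and> Wi i * W i = Z) \<and>
     (\<forall>i j. W j * e i * Wi j = (qparam (\<eta> j) powi pair k i j) \<odot> e i) \<and>
     (\<forall>i j. W j * f i * Wi j = (qparam (\<eta> j) powi (- pair k i j)) \<odot> f i) \<and>
     (\<forall>i j. e i * f j - f j * e i = (if i mod k = j mod k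
        then inverse (qv - inverse qv) \<odot> (W i * Wi (Suc i) - W (Suc i) * Wi i) else 0)) \<and>
     half_rels k \<eta> e \<and> half_rels k \<eta> f"

lemma full_relsD:
  assumes "full_rels k \<eta> Z W Wi e f"
  shows "W i * W j = W j * W i" "W i * Wi i = Z" "Wi i * W i = Z"
    "W j * e i * Wi j = (qparam (\<eta> j) powi pair k i j) \<odot> e i"
    "W j * f i * Wi j = (qparam (\<eta> j) powi (- pair k i j)) \<odot> f i"
    "i mod k = j mod k \<Longrightarrow> e i * f j - f j * e i
       = inverse (qv - inverse qv) \<odot> (W i * Wi (Suc i) - W (Suc i) * Wi i)"
    "i mod k \<noteq> j mod k \<Longrightarrow> e i * f j = f j * e i"
    "half_rels k \<eta> e" "half_rels k \<eta> f"
proof -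
  show "e i * f j = f j * e i" if "i mod k \<noteq> j mod k"
    using assms that unfolding full_rels_def by (metis eq_iff_diff_eq_0)
qed (use assms in \<open>unfold full_rels_def, presburger\<close>)+

lemma full_relsI:
  assumes k: "0 < k" and per: "\<And>i. \<eta> (i + k) = \<eta> i" "\<And>i. W (i + k) = W i" "\<And>i. Wi (i + k) = Wi i"
      "\<And>i. e (i + k) = e i" "\<And>i. f (i + k) = f i"
    and "\<And>i j. i < k \<Longrightarrow> j < k \<Longrightarrow> W i * W j = W j * W i"
    and "\<And>i. i < k \<Longrightarrow> W i * Wi i = Z" "\<And>i. i < k \<Longrightarrow> Wi i * W i = Z"
    and "\<And>i j. i < k \<Longrightarrow> j < k \<Longrightarrow> W j * e i * Wi j = (qparam (\<eta> j) powi pair k i j) \<odot> e i"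
    and "\<And>i j. i < k \<Longrightarrow> j < k \<Longrightarrow> W j * f i * Wi j = (qparam (\<eta> j) powi (- pair k i j)) \<odot> f i"
    and "\<And>i j. i < k \<Longrightarrow> j < k \<Longrightarrow> i \<noteq> j \<Longrightarrow> e i * f j = f j * e i"
    and "\<And>i. i < k \<Longrightarrow> e i * f i - f i * e i
       = inverse (qv - inverse qv) \<odot> (W i * Wi (Suc i) - W (Suc i) * Wi i)"
    and "half_rels k \<eta> e" "half_rels k \<eta> f"
  shows "full_rels k \<eta> Z W Wi e f"
proof -
  have m: "\<eta> (i mod k) = \<eta> i" "W (i mod k) = W i" "Wi (i mod k) = Wi i" "e (i mod k) = e i"
    "f (i mod k) = f i" for i
    using mod_cong_periodic[of \<eta> k] mod_cong_periodic[of W k] mod_cong_periodic[of Wi k]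
      mod_cong_periodic[of e k] mod_cong_periodic[of f k] per by simp_all
  have s: "W (Suc (i mod k)) = W (Suc i)" "Wi (Suc (i mod k)) = Wi (Suc i)" for i
    using m(2)[of "Suc i"] m(2)[of "Suc (i mod k)"] m(3)[of "Suc i"] m(3)[of "Suc (i mod k)"]
    by (simp_all add: mod_Suc_eq)
  have less: "i mod k < k" for i using k by simp
  show ?thesis
    unfolding full_rels_def
  proof (intro conjI allI)
    fix i j
    show "W i * W j = W j * W i" using assms(7)[OF less less, of i j] by (simp only: m)
    show "W i * Wi i = Z" "Wi i * W i = Z" using assms(8,9)[OF less, of i] by (simp_all only: m)
    show "W j * e i * Wi j = (qparam (\<eta> j) powi pair k i j) \<odot> e i"
      using assms(10)[OF less less, of j i] by (simp only: m pair_mod)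
    show "W j * f i * Wi j = (qparam (\<eta> j) powi (- pair k i j)) \<odot> f i"
      using assms(11)[OF less less, of j i] by (simp only: m pair_mod)
    show "e i * f j - f j * e i = (if i mod k = j mod k
        then inverse (qv - inverse qv) \<odot> (W i * Wi (Suc i) - W (Suc i) * Wi i) else 0)"
    proof (cases "i mod k = j mod k")
      case True
      then have "f j = f i" using m(5)[of i] m(5)[of j] by simp
      moreover have "e i * f i - f i * e i
          = inverse (qv - inverse qv) \<odot> (W i * Wi (Suc i) - W (Suc i) * Wi i)"
        using assms(13)[OF less, of i] by (simp only: m s)
      ultimately show ?thesis using True by simp
    next
      case False
      then show ?thesis using assms(12)[OF less less False] by (simp add: m)
    qed
  qed (use assms in auto)
qed

text \<open>Inserting \<open>w' * w = Z\<close> between the factors makes conjugation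
  multiplicative, so the weights of \<open>a\<close> and \<open>b\<close> multiply in both
  orders.\<close>

lemma weight_qcom:
  assumes "w' * w = Z" "a * Z = a" "b * Z = b" "w * a * w' = c \<odot> a" "w * b * w' = d \<odot> b"
  shows "w * qcom t a b * w' = (c * d) \<odot> qcom t a b"
proof -
  have *: "w * (a * b) * w' = (w * a * w') * (w * b * w')" "w * (b * a) * w' = (w * b * w') * (w * a * w')"
  proof -
    have "(w * a * w') * (w * b * w') = w * (a * (w' * w)) * (b * w')"
      "(w * b * w') * (w * a * w') = w * (b * (w' * w)) * (a * w')"
      by (simp_all only: mult.assoc)
    then show "w * (a * b) * w' = (w * a * w') * (w * b * w')"
        "w * (b * a) * w' = (w * b * w') * (w * a * w')"
      by (simp_all add: assms(1-3)) (simp_all add: mult.assoc)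
  qed
  have "w * qcom t a b * w' = w * (a * b) * w' - t \<odot> (w * (b * a) * w')"
    by (simp add: qcom_def right_diff_distrib left_diff_distrib sc_mult_left sc_mult_right)
  then show ?thesis
    unfolding * assms(4,5)
    by (simp add: qcom_def sc_mult_left sc_mult_right sc_diff_right sc_sc mult_ac)
qed

lemma qcom_commutes:
  assumes "a * y = y * a" "b * y = y * b"
  shows "qcom t a b * y = y * qcom t a b"
proof -
  have "a * (b * y) = y * (a * b)" "b * (a * y) = y * (b * a)"
    by (simp_all only: assms flip: mult.assoc)
  then show ?thesis
    by (simp add: qcom_def left_diff_distrib right_diff_distrib sc_mult_left sc_mult_right mult.assoc)
qed

text \<open>The new weight at index 0 is the old one at \<open>n - 1\<close>, and the weight
  \<open>W 0\<close> of the deleted position disappears. The merged root is the sum of the roots at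
  \<open>n - 1\<close> and 0, and the product of the two old \<open>k\<close> is
  \<open>W (n - 1) * Wi 1\<close>.\<close>

lemma merge_full_rels:
  assumes n: "4 \<le> n"
    and per: "\<And>i. \<eta> (i + n) = \<eta> i" "\<And>i. W (i + n) = W i" "\<And>i. Wi (i + n) = Wi i"
      "\<And>i. e (i + n) = e i" "\<And>i. f (i + n) = f i"
    and rng: "\<And>i. \<eta> i \<in> {0, 1}"
    and homog: "n = 4 \<Longrightarrow> \<eta> 1 = \<eta> 2 \<and> \<eta> 2 = \<eta> 3"
    and Z: "\<And>i. Z * e i = e i" "\<And>i. e i * Z = e i" "\<And>i. Z * f i = f i" "\<And>i. f i * Z = f i"
      "\<And>i. Z * W i = W i" "\<And>i. Z * Wi i = Wi i" "\<And>i. Wi i * Z = Wi i"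
    and R: "full_rels n \<eta> Z W Wi e f"
    and t: "t = inverse (qparam (\<eta> 0))"
  shows "full_rels (n - 1) (merge_seq n (\<eta> (n - 1)) \<eta>) Z (merge_seq n (W (n - 1)) W)
    (merge_seq n (Wi (n - 1)) Wi) (merge_seq n (qcom t (e (n - 1)) (e 0)) e)
    (merge_seq n (qcom (inverse t) (f 0) (f (n - 1))) f)"
proof -
  define E where "E = qcom t (e (n - 1)) (e 0)"
  define F where "F = qcom (inverse t) (f 0) (f (n - 1))"
  define h W' Wi' e' f' where "h = merge_seq n (\<eta> (n - 1)) \<eta>" and "W' = merge_seq n (W (n - 1)) W"
    and "Wi' = merge_seq n (Wi (n - 1)) Wi" and "e' = merge_seq n E e" and "f' = merge_seq n F f"
  note defs = h_def W'_def Wi'_def e'_def f'_def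
  note D = full_relsD[OF R]
  \<comment> \<open>Old index of a new weight; the old index 0 is the deleted one and is never
    hit.\<close>
  define s where "s j = (if j = 0 then n - 1 else j)" for j :: nat
  have s: "h j = \<eta> (s j)" "W' j = W (s j)" "Wi' j = Wi (s j)" if "j < n - 1" for j
    using that by (simp_all add: defs merge_seq_def s_def)
  have suc: "W' (Suc i) = W (Suc i)" "Wi' (Suc i) = Wi (Suc i)" if "i < n - 1" for i
    using that by (cases "Suc i = n - 1"; simp add: defs merge_seq_def)+
  have e'0: "e' 0 = E" "f' 0 = F" by (simp_all add: defs merge_seq_def)
  have e'1: "e' i = e i" "f' i = f i" if "0 < i" "i < n - 1" for i
    using that by (simp_all add: defs merge_seq_def)
  have t0: "t \<noteq> 0" by (simp add: t)
  \<comment> \<open>The order of the \<open>f\<close> is exchanged so that \<open>F\<close> has the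
    same shape as \<open>E\<close>, up to a scalar.\<close>
  have F: "F = (- inverse t) \<odot> qcom t (f (n - 1)) (f 0)"
    using qcom_swap[of "inverse t" "f 0" "f (n - 1)"] t0 by (simp add: F_def)
  have We: "W j * e i = (qparam (\<eta> j) powi pair n i j) \<odot> (e i * W j)"
    and Wie: "Wi j * e i = inverse (qparam (\<eta> j) powi pair n i j) \<odot> (e i * Wi j)"
    and Wf: "W j * f i = (qparam (\<eta> j) powi (- pair n i j)) \<odot> (f i * W j)"
    and Wif: "Wi j * f i = inverse (qparam (\<eta> j) powi (- pair n i j)) \<odot> (f i * Wi j)" for i j
    by (rule weight_commute[OF Z(2) D(3) D(4)]
        inverse_weight_commute[OF _ Z(1) D(3) D(4)] weight_commute[OF Z(4) D(3) D(5)]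
        inverse_weight_commute[OF _ Z(3) D(3) D(5)]; simp)+
  \<comment> \<open>As in a group, inverses of commuting weights commute;
    \<open>W i * Wi i = Z\<close> is inserted in place of 1.\<close>
  have WiW: "Wi i * W j = W j * Wi i" for i j
  proof -
    have "W j * Z = W j"
      using D(2,3)[of j] Z(5)[of j] by (metis mult.assoc)
    then have "Wi i * W j = Wi i * (W j * (W i * Wi i))"
      by (simp add: D(2))
    also have "\<dots> = Wi i * (W j * W i) * Wi i"
      by (simp add: mult.assoc)
    also have "\<dots> = (Wi i * W i) * W j * Wi i"
      by (simp add: D(1)[of j i] mult.assoc)
    finally show ?thesis
      by (simp add: D(3) Z(5))
  qed
  have WiWi: "Wi i * Wi j = Wi j * Wi i" for i j
  proof -
    have "Wi i * Wi j = Wi i * (Wi j * (W i * Wi i))"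
      by (simp add: D(2) Z(7))
    also have "\<dots> = Wi i * (Wi j * W i) * Wi i"
      by (simp add: mult.assoc)
    also have "\<dots> = (Wi i * W i) * Wi j * Wi i"
      by (simp only: WiW[of j i] mult.assoc)
    finally show ?thesis
      by (simp add: D(3) Z(6))
  qed
  have nl: "n - 1 < n" "0 < n" "1 < n" and sl: "s j < n" if "j < n - 1" for j
    using n that by (auto simp: s_def)
  have "full_rels (n - 1) h Z W' Wi' e' f'"
  proof (rule full_relsI)
    show "0 < n - 1" using n by simp
    show "h (i + (n - 1)) = h i" "W' (i + (n - 1)) = W' i" "Wi' (i + (n - 1)) = Wi' i"
      "e' (i + (n - 1)) = e' i" "f' (i + (n - 1)) = f' i" for i
      by (simp_all only: defs merge_seq_periodic)
    show "half_rels (n - 1) h e'"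
      unfolding h_def e'_def
      by (rule merge_half_rels[OF n per(1,4) rng homog D(8), where l = 1])
        (simp_all add: E_def t sc_one)
    show "half_rels (n - 1) h f'"
      unfolding h_def f'_def
      by (rule merge_half_rels[OF n per(1,5) rng homog D(9), where l = "- inverse t"])
        (simp_all add: F flip: t)
  next
    fix i j assume ij: "i < n - 1" "j < n - 1"
    show "W' i * W' j = W' j * W' i" using ij D(1) by (simp add: s)
    have pair1: "pair (n - 1) i j = pair n i (s j)" if "0 < i"
      using that ij n by (auto simp: pair_less s_def)
    \<comment> \<open>The contributions of the deleted position to the two old roots are never
      evaluated, since \<open>s j\<close> avoids it.\<close>
    have pair0: "pair (n - 1) 0 j = pair n (n - 1) (s j) + pair n 0 (s j)"
      using ij n by (auto simp: pair_less s_def)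
    show "W' j * e' i * Wi' j = (qparam (h j) powi pair (n - 1) i j) \<odot> e' i"
    proof (cases "i = 0")
      case True
      have "W (s j) * E * Wi (s j) = (qparam (\<eta> (s j)) powi pair n (n - 1) (s j)
          * qparam (\<eta> (s j)) powi pair n 0 (s j)) \<odot> E"
        unfolding E_def by (rule weight_qcom[OF D(3) Z(2) Z(2) D(4) D(4)])
      then show ?thesis
        using ij True by (simp only: s e'0 pair0 power_int_add qparam_nonzero simp_thms)
    next
      case False
      then show ?thesis using ij D(4) pair1 by (simp add: s e'1)
    qed
    show "W' j * f' i * Wi' j = (qparam (h j) powi (- pair (n - 1) i j)) \<odot> f' i"
    proof (cases "i = 0")
      case True
      have "W (s j) * F * Wi (s j) = (qparam (\<eta> (s j)) powi (- pair n 0 (s j))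
          * qparam (\<eta> (s j)) powi (- pair n (n - 1) (s j))) \<odot> F"
        unfolding F_def by (rule weight_qcom[OF D(3) Z(4) Z(4) D(5) D(5)])
      moreover have "- pair (n - 1) 0 j = - pair n 0 (s j) + - pair n (n - 1) (s j)"
        using pair0 by simp
      ultimately show ?thesis
        using ij True by (simp only: s e'0 power_int_add qparam_nonzero simp_thms)
    next
      case False
      then show ?thesis using ij D(5) pair1 by (simp add: s e'1)
    qed
    assume "i \<noteq> j"
    then consider "i = 0" "0 < j" | "j = 0" "0 < i" | "0 < i" "0 < j" by auto
    then show "e' i * f' j = f' j * e' i"
    proof cases
      case 1
      have "E * f j = f j * E"
        unfolding E_def using 1 ij by (intro qcom_commutes D(7)) auto
      then show ?thesis using 1 ij by (simp add: e'0 e'1)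
    next
      case 2
      have "F * e i = e i * F"
        unfolding F_def using 2 ij by (intro qcom_commutes D(7)[symmetric]) auto
      then show ?thesis using 2 ij by (simp add: e'0 e'1)
    next
      case 3
      then show ?thesis using D(7)[of i j] ij \<open>i \<noteq> j\<close> by (simp add: e'1)
    qed
  next
    fix i assume i: "i < n - 1"
    show "W' i * Wi' i = Z" "Wi' i * W' i = Z" using i D(2,3) by (simp_all add: s)
    show "e' i * f' i - f' i * e' i
        = inverse (qv - inverse qv) \<odot> (W' i * Wi' (Suc i) - W' (Suc i) * Wi' i)"
    proof (cases "i = 0")
      case False
      then show ?thesis using i D(6)[of i i] suc[OF i] s[OF i] by (simp add: e'1 s_def)
    next
      case True
      define u where "u = inverse t"
      define \<kappa> where "\<kappa> = inverse (qv - inverse qv)"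
      have u: "qparam (\<eta> 0) = u" "u \<noteq> 0" "inverse u = t" "inverse t = u" "t * 1 = t" by (simp_all add: u_def t)
      have Wn: "W n = W 0" "Wi n = Wi 0" "Suc (n - 1) = n" using per(2,3)[of 0] n by simp_all
      have pr: "pair n 0 0 = 1" "pair n 0 (n - 1) = 0" "pair n (n - 1) (n - 1) = 1"
        "pair n (n - 1) 0 = -1" "pair n (n - 1) 1 = 0"
        using n by (simp_all add: pair_less)
      note comm = We[of "n - 1" 0] Wie[of 0 0] We[of 0 0] Wie[of "n - 1" 0]
        We[of 0 "n - 1"] Wie[of 1 "n - 1"] We[of 1 "n - 1"] Wie[of 0 "n - 1"]
        Wf[of 0 "n - 1"] Wif[of 1 "n - 1"] Wf[of 0 0] Wif[of "n - 1" 0]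
      note comm' = comm[unfolded pr u(1) minus_minus minus_zero power_int_minus power_int_0_right
          power_int_1_right inverse_1 u inverse_inverse_eq]
      have "E * F - F * E = (\<kappa> * \<kappa> * (u - t)) \<odot> (W (n - 1) * Wi 0 * (W 0 * Wi 1) - W 1 * Wi 0 * (W 0 * Wi (n - 1)))"
        unfolding E_def F_def u(4)
      proof (rule qcom_bracket[OF t0])
        show "u = inverse t" by (simp add: u_def)
        show "e (n - 1) * f (n - 1) = f (n - 1) * e (n - 1) + \<kappa> \<odot> (W (n - 1) * Wi 0 - W 0 * Wi (n - 1))"
          using D(6)[of "n - 1" "n - 1", unfolded Wn] by (simp add: \<kappa>_def algebra_simps)
        show "e 0 * f 0 = f 0 * e 0 + \<kappa> \<odot> (W 0 * Wi 1 - W 1 * Wi 0)"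
          using D(6)[of 0 0] by (simp add: \<kappa>_def algebra_simps)
        show "e (n - 1) * f 0 = f 0 * e (n - 1)" "e 0 * f (n - 1) = f (n - 1) * e 0"
          using n by (simp_all add: D(7))
        show "W (n - 1) * Wi 0 * e 0 = t \<odot> (e 0 * (W (n - 1) * Wi 0))"
          using mult_weight_commute[OF comm'(1,2)] by simp
        show "W 0 * Wi (n - 1) * e 0 = u \<odot> (e 0 * (W 0 * Wi (n - 1)))"
          using mult_weight_commute[OF comm'(3,4)] by simp
        show "W 0 * Wi 1 * e (n - 1) = t \<odot> (e (n - 1) * (W 0 * Wi 1))"
          using mult_weight_commute[OF comm'(5,6)] by simp
        show "W 1 * Wi 0 * e (n - 1) = u \<odot> (e (n - 1) * (W 1 * Wi 0))"
          using mult_weight_commute[OF comm'(7,8)] by simp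
        show "W 0 * Wi 1 * f (n - 1) = u \<odot> (f (n - 1) * (W 0 * Wi 1))"
          using mult_weight_commute[OF comm'(9,10)] by simp
        show "W 0 * Wi (n - 1) * f 0 = t \<odot> (f 0 * (W 0 * Wi (n - 1)))"
          using mult_weight_commute[OF comm'(11,12)] by simp
        show "W 0 * Wi (n - 1) * (W 0 * Wi 1) = W 0 * Wi 1 * (W 0 * Wi (n - 1))"
        proof -
          have "W 0 * Wi (n - 1) * (W 0 * Wi 1) = W 0 * (Wi (n - 1) * W 0) * Wi 1"
            by (simp add: mult.assoc)
          also have "\<dots> = W 0 * W 0 * (Wi (n - 1) * Wi 1)"
            by (simp only: WiW mult.assoc)
          also have "\<dots> = W 0 * (W 0 * Wi 1) * Wi (n - 1)"
            by (simp only: WiWi[of "n - 1"] mult.assoc)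
          also have "\<dots> = W 0 * (Wi 1 * W 0) * Wi (n - 1)"
            by (simp only: WiW)
          finally show ?thesis by (simp only: mult.assoc)
        qed
      qed
      \<comment> \<open>The deleted weight meets its own inverse.\<close>
      also have "W (n - 1) * Wi 0 * (W 0 * Wi 1) = W (n - 1) * (Wi 0 * W 0) * Wi 1"
        by (simp only: mult.assoc)
      also have "\<dots> = W (n - 1) * Wi 1"
        by (simp only: D(3) mult.assoc Z)
      also have "W 1 * Wi 0 * (W 0 * Wi (n - 1)) = W 1 * (Wi 0 * W 0) * Wi (n - 1)"
        by (simp only: mult.assoc)
      also have "\<dots> = W 1 * Wi (n - 1)"
        by (simp only: D(3) mult.assoc Z)
      \<comment> \<open>Here \<open>u\<close> is q at the deleted position and \<open>t\<close> its
        inverse, so \<open>u - t\<close> is \<open>qv - inverse qv\<close>, the inverse of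
        \<open>\<kappa>\<close>.\<close>
      also have "\<kappa> * \<kappa> * (u - t) = \<kappa>"
        using qparam_diff[of "\<eta> 0"] qv_diff_nonzero by (simp add: \<kappa>_def u flip: t)
      finally show ?thesis
        using True s[OF i] suc[OF i] by (simp add: e'0 s_def \<kappa>_def)
    qed
  qed
  then show ?thesis by (simp only: defs E_def F_def)
qed

end

section \<open>The quotient algebras\<close>

text \<open>The kernel of \<open>h\<close> is an ideal containing \<open>A\<close>, hence contains
  the ideal generated by \<open>A\<close>. So \<open>h\<close> is constant on every coset, and
  \<open>the_elem\<close> of the image of a coset gives a well-defined value.\<close>

lemma genideal_quotient_factor:
  assumes "ring_hom_ring R S h" "A \<subseteq> carrier R" "\<And>a. a \<in> A \<Longrightarrow> h a = \<zero>\<^bsub>S\<^esub>"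
  shows "\<exists>\<phi>. \<phi> \<in> ring_hom (R Quot (Idl\<^bsub>R\<^esub> A)) S \<and> (\<forall>x\<in>carrier R. \<phi> (Idl\<^bsub>R\<^esub> A +>\<^bsub>R\<^esub> x) = h x)"
proof -
  interpret ring_hom_ring R S h by (rule assms)
  define I where "I = Idl\<^bsub>R\<^esub> A"
  have I: "ideal I R"
    unfolding I_def by (rule R.genideal_ideal[OF assms(2)])
  have "I \<subseteq> a_kernel R S h"
    unfolding I_def
  proof (rule R.genideal_minimal[OF kernel_is_ideal], rule subsetI)
    fix a assume "a \<in> A"
    then show "a \<in> a_kernel R S h"
      using assms(2) assms(3)[of a] unfolding a_kernel_def' by blast
  qed
  then have zero: "h i = \<zero>\<^bsub>S\<^esub>" if "i \<in> I" for i
    using that unfolding a_kernel_def' by blast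
  define \<phi> where "\<phi> X = the_elem (h ` X)" for X
  have \<phi>: "\<phi> (I +>\<^bsub>R\<^esub> x) = h x" if x: "x \<in> carrier R" for x
  proof -
    have "h y = h x" if y: "y \<in> I +>\<^bsub>R\<^esub> x" for y
    proof -
      obtain i where i: "i \<in> I" "y = i \<oplus>\<^bsub>R\<^esub> x"
        using y unfolding a_r_coset_def' by blast
      then have "h y = h i \<oplus>\<^bsub>S\<^esub> h x"
        using x ideal.Icarr[OF I i(1)] by simp
      then show ?thesis
        using x i(1) by (simp add: zero)
    qed
    moreover have "x \<in> I +>\<^bsub>R\<^esub> x"
      using x additive_subgroup.zero_closed[OF ideal.axioms(1)[OF I]]
      by (auto simp: a_r_coset_def' intro!: bexI[of _ "\<zero>\<^bsub>R\<^esub>"])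
    ultimately have "h ` (I +>\<^bsub>R\<^esub> x) = {h x}" by blast
    then show ?thesis by (simp add: \<phi>_def)
  qed
  have rcos: "(+>\<^bsub>R\<^esub>) I \<in> ring_hom R (R Quot I)"
    by (rule ideal.rcos_ring_hom[OF I])
  have surj: "\<exists>x\<in>carrier R. X = I +>\<^bsub>R\<^esub> x" if "X \<in> carrier (R Quot I)" for X
    using that by (auto simp: FactRing_def A_RCOSETS_def')
  have "\<phi> \<in> ring_hom (R Quot I) S"
  proof (rule ring_hom_memI)
    fix X Y assume X: "X \<in> carrier (R Quot I)" and Y: "Y \<in> carrier (R Quot I)"
    obtain x y where xy: "x \<in> carrier R" "X = I +>\<^bsub>R\<^esub> x" "y \<in> carrier R" "Y = I +>\<^bsub>R\<^esub> y"
      using surj[OF X] surj[OF Y] by blast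
    show "\<phi> X \<in> carrier S"
      by (simp only: xy(2) \<phi>[OF xy(1)] hom_closed[OF xy(1)])
    show "\<phi> (X \<otimes>\<^bsub>R Quot I\<^esub> Y) = \<phi> X \<otimes>\<^bsub>S\<^esub> \<phi> Y"
      by (simp only: xy(2,4) \<phi>[OF xy(1)] \<phi>[OF xy(3)] hom_mult[OF xy(1,3)]
          \<phi>[OF R.m_closed[OF xy(1,3)]] ring_hom_mult[OF rcos xy(1,3), symmetric])
    show "\<phi> (X \<oplus>\<^bsub>R Quot I\<^esub> Y) = \<phi> X \<oplus>\<^bsub>S\<^esub> \<phi> Y"
      by (simp only: xy(2,4) \<phi>[OF xy(1)] \<phi>[OF xy(3)] hom_add[OF xy(1,3)]
          \<phi>[OF R.add.m_closed[OF xy(1,3)]] ring_hom_add[OF rcos xy(1,3), symmetric])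
  next
    show "\<phi> \<one>\<^bsub>R Quot I\<^esub> = \<one>\<^bsub>S\<^esub>"
      by (simp only: ring_hom_one[OF rcos, symmetric] \<phi>[OF R.one_closed] hom_one)
  qed
  with \<phi> show ?thesis unfolding I_def by blast
qed

section \<open>The class map onto the quotient and its scalars\<close>

lemma valid_gen_simps [simp]:
  "valid_gen k (Eg i) \<longleftrightarrow> i < k" "valid_gen k (Fg i) \<longleftrightarrow> i < k"
  "valid_gen k (Om j) \<longleftrightarrow> 1 \<le> j \<and> j \<le> k" "valid_gen k (Omi j) \<longleftrightarrow> 1 \<le> j \<and> j \<le> k"
  by (simp_all add: valid_gen_def)

lemma widx_bounds: "eps \<noteq> [] \<Longrightarrow> Suc 0 \<le> widx eps j \<and> widx eps j \<le> length eps"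
  by (auto simp: widx_def less_imp_le Suc_le_eq mod_greater_zero_iff_not_dvd)

lemma gens_in_falg [simp]:
  assumes "eps \<noteq> []"
  shows "om eps i \<in> falg (length eps)" "omi eps i \<in> falg (length eps)"
    "ee eps i \<in> falg (length eps)" "ff eps i \<in> falg (length eps)"
    "kk eps i \<in> falg (length eps)" "kki eps i \<in> falg (length eps)"
  using assms widx_bounds[OF assms] by (simp_all add: om_def omi_def ee_def ff_def kk_def kki_def)

lemma serre_in_falg [simp]: "(\<And>i. x eps i \<in> falg k) \<Longrightarrow> serre eps x i j \<in> falg k"
  by (simp add: serre_def)

lemma quartic_in_falg [simp]: "(\<And>i. x eps i \<in> falg k) \<Longrightarrow> quartic eps x i \<in> falg k"
  by (simp add: quartic_def Let_def)

text \<open>The generated ideal is obtained from generators inside the carrier. The empty list is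
  covered as well, because the product of all quotients below ranges over every list.\<close>

lemma rels_subset: "rels eps \<subseteq> falg (length eps)"
proof (cases "eps = []")
  case True
  then show ?thesis by (simp add: rels_def)
next
  case False
  have falg_if: "(if P then a else b) \<in> falg k" if "a \<in> falg k" "b \<in> falg k" for P a b k
    using that by simp
  show ?thesis
    unfolding rels_def Let_def
    by (intro Un_least subsetI; elim CollectE exE conjE; hypsubst;
        intro falg_mult falg_add falg_sub falg_smult falg_if falg_prod serre_in_falg quartic_in_falg;
        simp add: False)
qed

lemma ideal_rels: "ideal (Idl\<^bsub>free_alg (length eps)\<^esub> (rels eps)) (free_alg (length eps))"
  by (rule ring.genideal_ideal[OF ring_free_alg rels_subset])

lemma ring_Uq: "ring (Uq eps)"
  unfolding Uq_def by (rule ideal.quotient_is_ring[OF ideal_rels])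

lemma cls_ring_hom: "cls eps \<in> ring_hom (free_alg (length eps)) (Uq eps)"
  unfolding Uq_def cls_def[abs_def] by (rule ideal.rcos_ring_hom[OF ideal_rels])

lemma cls_simps:
  "a \<in> falg (length eps) \<Longrightarrow> cls eps a \<in> carrier (Uq eps)"
  "a \<in> falg (length eps) \<Longrightarrow> b \<in> falg (length eps) \<Longrightarrow> cls eps (fa_mult a b) = cls eps a \<otimes>\<^bsub>Uq eps\<^esub> cls eps b"
  "a \<in> falg (length eps) \<Longrightarrow> b \<in> falg (length eps) \<Longrightarrow> cls eps (fa_add a b) = cls eps a \<oplus>\<^bsub>Uq eps\<^esub> cls eps b"
  "cls eps (fa_const 1) = \<one>\<^bsub>Uq eps\<^esub>" "cls eps (fa_const 0) = \<zero>\<^bsub>Uq eps\<^esub>"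
proof -
  interpret h: ring_hom_ring "free_alg (length eps)" "Uq eps" "cls eps"
    by (rule ring_hom_ringI2[OF ring_free_alg ring_Uq cls_ring_hom])
  show "a \<in> falg (length eps) \<Longrightarrow> cls eps a \<in> carrier (Uq eps)" by simp
  show "a \<in> falg (length eps) \<Longrightarrow> b \<in> falg (length eps) \<Longrightarrow> cls eps (fa_mult a b) = cls eps a \<otimes>\<^bsub>Uq eps\<^esub> cls eps b"
    using h.hom_mult by simp
  show "a \<in> falg (length eps) \<Longrightarrow> b \<in> falg (length eps) \<Longrightarrow> cls eps (fa_add a b) = cls eps a \<oplus>\<^bsub>Uq eps\<^esub> cls eps b"
    using h.hom_add by simp
  show "cls eps (fa_const 1) = \<one>\<^bsub>Uq eps\<^esub>" "cls eps (fa_const 0) = \<zero>\<^bsub>Uq eps\<^esub>"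
    using h.hom_one h.hom_zero by (simp_all only: free_alg_simps fa_zero_eq)
qed

lemma Uq_surj: "X \<in> carrier (Uq eps) \<Longrightarrow> \<exists>x\<in>falg (length eps). X = cls eps x"
  by (auto simp: Uq_def cls_def FactRing_def A_RCOSETS_def')

lemma cls_rels: "x \<in> rels eps \<Longrightarrow> cls eps x = \<zero>\<^bsub>Uq eps\<^esub>"
proof -
  assume x: "x \<in> rels eps"
  have "x \<in> Idl\<^bsub>free_alg (length eps)\<^esub> (rels eps)"
    using ring.genideal_self[OF ring_free_alg rels_subset, of eps] x by blast
  then have "cls eps x = Idl\<^bsub>free_alg (length eps)\<^esub> (rels eps)"
    unfolding cls_def by (rule ring.a_rcos_zero[OF ring_free_alg ideal_rels])
  then show ?thesis
    by (simp add: Uq_def FactRing_def)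
qed

lemma fa_const_mult_commute: "fa_mult (fa_const c) x = fa_mult x (fa_const c)"
  by (simp add: fa_mult_const_left fa_mult_const_right)

lemma cls_const_central:
  "X \<in> carrier (Uq eps) \<Longrightarrow> cls eps (fa_const c) \<otimes>\<^bsub>Uq eps\<^esub> X = X \<otimes>\<^bsub>Uq eps\<^esub> cls eps (fa_const c)"
  by (metis Uq_surj cls_simps(2) fa_const_mult_commute falg_const)

lemma fa_const_add: "fa_const (c + d) = fa_add (fa_const c) (fa_const d)"
  by (simp add: fa_const_def fa_add_def fun_eq_iff)

lemma fa_const_mult: "fa_const (c * d) = fa_mult (fa_const c) (fa_const d)"
  by (simp add: fa_mult_const_left) (simp add: fa_const_def fa_smult_def fun_eq_iff)

text \<open>
  \<open>Uq eps\<close> depends on the term \<open>eps\<close> and so is not a type. The product of all \<open>Uq eps\<close> is one, and each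
  factor embeds into it, without preserving \<open>1\<close>. This makes the type class of rings and its simplification
  rules available for computing in a single \<open>Uq eps\<close>.
\<close>

typedef uprod = "{x :: nat list \<Rightarrow> elt set. \<forall>eps. x eps \<in> carrier (Uq eps)}"
  by (rule exI[of _ "\<lambda>eps. cls eps (fa_const 0)"]) (simp add: cls_simps(1))

lemma uprod_eqI: "(\<And>eps. Rep_uprod x eps = Rep_uprod y eps) \<Longrightarrow> x = y"
  by (simp add: ext flip: Rep_uprod_inject)

lemma Rep_uprod_closed [simp]: "Rep_uprod x eps \<in> carrier (Uq eps)"
  using Rep_uprod[of x] by simp

text \<open>The class \<open>ring_1\<close> would also demand \<open>0 \<noteq> 1\<close>;
  \<open>monoid_mult\<close> already supplies the unit that \<open>prod_list\<close> uses when words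
  are evaluated.\<close>

instantiation uprod :: "{ring, monoid_mult}"
begin

definition "0 = Abs_uprod (\<lambda>eps. \<zero>\<^bsub>Uq eps\<^esub>)"
definition "1 = Abs_uprod (\<lambda>eps. \<one>\<^bsub>Uq eps\<^esub>)"
definition "x + y = Abs_uprod (\<lambda>eps. Rep_uprod x eps \<oplus>\<^bsub>Uq eps\<^esub> Rep_uprod y eps)"
definition "x * y = Abs_uprod (\<lambda>eps. Rep_uprod x eps \<otimes>\<^bsub>Uq eps\<^esub> Rep_uprod y eps)"
definition "- x = Abs_uprod (\<lambda>eps. \<ominus>\<^bsub>Uq eps\<^esub> Rep_uprod x eps)"
definition "x - y = Abs_uprod (\<lambda>eps. Rep_uprod x eps \<ominus>\<^bsub>Uq eps\<^esub> Rep_uprod y eps)"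

lemma Rep_uprod_simps:
  "Rep_uprod 0 eps = \<zero>\<^bsub>Uq eps\<^esub>" "Rep_uprod 1 eps = \<one>\<^bsub>Uq eps\<^esub>"
  "Rep_uprod (x + y) eps = Rep_uprod x eps \<oplus>\<^bsub>Uq eps\<^esub> Rep_uprod y eps"
  "Rep_uprod (x * y) eps = Rep_uprod x eps \<otimes>\<^bsub>Uq eps\<^esub> Rep_uprod y eps"
  "Rep_uprod (- x) eps = \<ominus>\<^bsub>Uq eps\<^esub> Rep_uprod x eps"
  "Rep_uprod (x - y) eps = Rep_uprod x eps \<ominus>\<^bsub>Uq eps\<^esub> Rep_uprod y eps"
  using ring.ring_simprules(1-6)[OF ring_Uq]
  by (simp_all add: zero_uprod_def one_uprod_def plus_uprod_def times_uprod_def uminus_uprod_def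
      minus_uprod_def Abs_uprod_inverse)

instance
proof
  fix x y z :: uprod
  show "x * 1 = x"
    by (rule uprod_eqI) (simp add: Rep_uprod_simps monoid.r_one[OF ring.is_monoid[OF ring_Uq]])
  note ring = ring.ring_simprules[OF ring_Uq]
  show "x + y + z = x + (y + z)" "x + y = y + x" "x * y * z = x * (y * z)"
    by (rule uprod_eqI; simp add: Rep_uprod_simps ring)+
  show "0 + x = x" "- x + x = 0" "1 * x = x"
    by (rule uprod_eqI; simp add: Rep_uprod_simps ring)+
  show "(x + y) * z = x * z + y * z" "x * (y + z) = x * y + x * z"
    by (rule uprod_eqI; simp only: Rep_uprod_simps ring Rep_uprod_closed)+
  show "x - y = x + - y"
    by (rule uprod_eqI) (simp only: Rep_uprod_simps a_minus_def)
qed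

end

definition uscale :: "Qq \<Rightarrow> uprod \<Rightarrow> uprod" (infixr "*\<^sub>U" 75) where
  "c *\<^sub>U x = Abs_uprod (\<lambda>eps. cls eps (fa_const c) \<otimes>\<^bsub>Uq eps\<^esub> Rep_uprod x eps)"

lemma Rep_uscale: "Rep_uprod (c *\<^sub>U x) eps = cls eps (fa_const c) \<otimes>\<^bsub>Uq eps\<^esub> Rep_uprod x eps"
  using ring.ring_simprules(5)[OF ring_Uq] by (simp add: uscale_def Abs_uprod_inverse cls_simps)

interpretation U: q_scaled_ring uscale
proof
  fix c d :: Qq and x y :: uprod
  note R = Rep_uscale Rep_uprod_simps cls_simps fa_const_add fa_const_mult
  note ring = ring.ring_simprules[OF ring_Uq]
  show "c *\<^sub>U (x + y) = c *\<^sub>U x + c *\<^sub>U y" "(c + d) *\<^sub>U x = c *\<^sub>U x + d *\<^sub>U x"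
    "c *\<^sub>U d *\<^sub>U x = (c * d) *\<^sub>U x" "1 *\<^sub>U x = x" "(c *\<^sub>U x) * y = c *\<^sub>U (x * y)"
    by (rule uprod_eqI; simp add: R ring del: One_nat_def)+
  show "x * c *\<^sub>U y = c *\<^sub>U (x * y)"
  proof (rule uprod_eqI)
    fix eps
    have "Rep_uprod x eps \<otimes>\<^bsub>Uq eps\<^esub> (cls eps (fa_const c) \<otimes>\<^bsub>Uq eps\<^esub> Rep_uprod y eps)
        = (Rep_uprod x eps \<otimes>\<^bsub>Uq eps\<^esub> cls eps (fa_const c)) \<otimes>\<^bsub>Uq eps\<^esub> Rep_uprod y eps"
      by (simp add: ring cls_simps)
    also have "\<dots> = cls eps (fa_const c) \<otimes>\<^bsub>Uq eps\<^esub> (Rep_uprod x eps \<otimes>\<^bsub>Uq eps\<^esub> Rep_uprod y eps)"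
      by (simp only: cls_const_central[OF Rep_uprod_closed, symmetric]) (simp add: ring cls_simps)
    finally show "Rep_uprod (x * c *\<^sub>U y) eps = Rep_uprod (c *\<^sub>U (x * y)) eps"
      by (simp only: Rep_uscale Rep_uprod_simps)
  qed
qed

section \<open>The defining relations as identities between images of generators\<close>

lemma fa_prod_simps:
  "fa_prod [x, y, z] = fa_mult x (fa_mult y z)"
  "fa_prod [x, y, z, w] = fa_mult x (fa_mult y (fa_mult z w))"
  by (simp_all add: fa_prod_def fa_mult_const_right)

lemma fa_const_smult: "fa_const c = fa_smult c (fa_const 1)"
  by (simp add: fa_const_def fa_smult_def fun_eq_iff)

lemma ball_rels:
  fixes eps :: "nat list"
  defines "k \<equiv> length eps"
  shows "(\<forall>x\<in>rels eps. P x) \<longleftrightarrow>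
     (\<forall>a b. 1 \<le> a \<and> a \<le> k \<and> 1 \<le> b \<and> b \<le> k \<longrightarrow>
        P (fa_sub (fa_mult (om eps a) (om eps b)) (fa_mult (om eps b) (om eps a)))) \<and>
     (\<forall>a. 1 \<le> a \<and> a \<le> k \<longrightarrow> P (fa_sub (fa_mult (om eps a) (omi eps a)) (fa_const 1))) \<and>
     (\<forall>a. 1 \<le> a \<and> a \<le> k \<longrightarrow> P (fa_sub (fa_mult (omi eps a) (om eps a)) (fa_const 1))) \<and>
     (\<forall>i j. i < k \<and> 1 \<le> j \<and> j \<le> k \<longrightarrow> P (fa_sub (fa_prod [om eps j, ee eps i, omi eps j])
        (fa_smult (qj eps j powi pairing eps i j) (ee eps i)))) \<and>
     (\<forall>i j. i < k \<and> 1 \<le> j \<and> j \<le> k \<longrightarrow> P (fa_sub (fa_prod [om eps j, ff eps i, omi eps j])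
        (fa_smult (qj eps j powi (- pairing eps i j)) (ff eps i)))) \<and>
     (\<forall>i j. i < k \<and> j < k \<longrightarrow>
        P (fa_sub (fa_sub (fa_mult (ee eps i) (ff eps j)) (fa_mult (ff eps j) (ee eps i)))
          (if i = j then fa_smult (inverse (qv - inverse qv)) (fa_sub (kk eps i) (kki eps i))
           else fa_const 0))) \<and>
     (\<forall>i. i < k \<and> \<not> even_idx eps i \<longrightarrow> P (fa_mult (ee eps i) (ee eps i))) \<and>
     (\<forall>i. i < k \<and> \<not> even_idx eps i \<longrightarrow> P (fa_mult (ff eps i) (ff eps i))) \<and>
     (\<forall>i j. i < k \<and> j < k \<and> i \<noteq> j \<and> \<not> adjacent k i j \<longrightarrow>
        P (fa_sub (fa_mult (ee eps i) (ee eps j)) (fa_mult (ee eps j) (ee eps i)))) \<and>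
     (\<forall>i j. i < k \<and> j < k \<and> i \<noteq> j \<and> \<not> adjacent k i j \<longrightarrow>
        P (fa_sub (fa_mult (ff eps i) (ff eps j)) (fa_mult (ff eps j) (ff eps i)))) \<and>
     (\<forall>i j. i < k \<and> j < k \<and> even_idx eps i \<and> adjacent k i j \<longrightarrow> P (serre eps ee i j)) \<and>
     (\<forall>i j. i < k \<and> j < k \<and> even_idx eps i \<and> adjacent k i j \<longrightarrow> P (serre eps ff i j)) \<and>
     (\<forall>i. i < k \<and> \<not> even_idx eps i \<longrightarrow> P (quartic eps ee i)) \<and>
     (\<forall>i. i < k \<and> \<not> even_idx eps i \<longrightarrow> P (quartic eps ff i))"
proof -
  have 1: "(\<forall>x\<in>{f a | a. Q a}. P x) \<longleftrightarrow> (\<forall>a. Q a \<longrightarrow> P (f a))" for f and Q :: "nat \<Rightarrow> bool"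
    by blast
  have 2: "(\<forall>x\<in>{f a b | a b. Q a b}. P x) \<longleftrightarrow> (\<forall>a b. Q a b \<longrightarrow> P (f a b))"
    for f and Q :: "nat \<Rightarrow> nat \<Rightarrow> bool"
    by blast
  show ?thesis
    unfolding rels_def Let_def ball_Un 1 2 k_def conj_assoc by (rule refl)
qed

lemma om_widx: "eps \<noteq> [] \<Longrightarrow> om eps (widx eps j) = om eps j" "eps \<noteq> [] \<Longrightarrow> omi eps (widx eps j) = omi eps j"
  by (auto simp: om_def omi_def widx_def)

lemma gens_periodic:
  "om eps (i + length eps) = om eps i" "omi eps (i + length eps) = omi eps i"
  "ee eps (i + length eps) = ee eps i" "ff eps (i + length eps) = ff eps i"
  "eps \<noteq> [] \<Longrightarrow> eps_at eps (i + length eps) = eps_at eps i"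
proof -
  show "eps_at eps (i + length eps) = eps_at eps i" if "eps \<noteq> []"
  proof -
    have "i + length eps + length eps - 1 = (i + length eps - 1) + length eps"
      using that by (cases eps) simp_all
    then show ?thesis by (simp only: eps_at_def mod_add_self2)
  qed
qed (simp_all add: om_def omi_def ee_def ff_def widx_def)

lemma qj_eq: "qj eps j = qparam (eps_at eps j)"
  by (simp add: qj_def qparam_def)

lemma pairing_eq: "pairing eps = pair (length eps)"
  by (simp add: pairing_def pair_def Let_def fun_eq_iff)

lemma pair_widx: "pair (length eps) i (widx eps j) = pair (length eps) i j"
  by (auto simp: widx_def pair_def)

lemma eps_at_widx: "eps \<noteq> [] \<Longrightarrow> eps_at eps (widx eps j) = eps_at eps j"
  using mod_cong_periodic[of "eps_at eps" "length eps" j] gens_periodic(5)[of eps 0]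
  by (auto simp: gens_periodic widx_def)

locale alg_map = q_scaled_ring +
  fixes eps :: "nat list" and H :: "elt \<Rightarrow> 'a"
  assumes nonempty: "eps \<noteq> []"
    and map_add: "x \<in> falg (length eps) \<Longrightarrow> y \<in> falg (length eps) \<Longrightarrow> H (fa_add x y) = H x + H y"
    and map_mult: "x \<in> falg (length eps) \<Longrightarrow> y \<in> falg (length eps) \<Longrightarrow> H (fa_mult x y) = H x * H y"
    and map_smult: "x \<in> falg (length eps) \<Longrightarrow> H (fa_smult c x) = c \<odot> H x"
begin

lemma map_sub: "x \<in> falg (length eps) \<Longrightarrow> y \<in> falg (length eps) \<Longrightarrow> H (fa_sub x y) = H x - H y"
  by (simp add: fa_sub_eq map_add map_smult sc_minus_left sc_one)

lemma map_const: "H (fa_const c) = c \<odot> H (fa_const 1)"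
  by (subst fa_const_smult) (simp add: map_smult)

lemma map_const_0: "H (fa_const 0) = 0"
  by (subst map_const) simp

lemmas map_simps = map_add map_mult map_smult map_sub map_const_0 fa_prod_simps
  gens_in_falg[OF nonempty] falg_mult falg_add falg_sub falg_smult falg_const

lemma map_serre:
  "H (serre eps ee i j) = serre_el ((- 1) ^ eps_at eps i * qbr2) (H (ee eps i)) (H (ee eps j))"
  "H (serre eps ff i j) = serre_el ((- 1) ^ eps_at eps i * qbr2) (H (ff eps i)) (H (ff eps j))"
  by (simp_all add: serre_def serre_el_def map_simps sgn_eps_def mult.assoc)

lemma map_quartic:
  "H (quartic eps ee i) = quartic_el ((- 1) ^ eps_at eps i * qbr2)
     (H (ee eps (i + length eps - 1))) (H (ee eps i)) (H (ee eps (Suc i)))"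
  "H (quartic eps ff i) = quartic_el ((- 1) ^ eps_at eps i * qbr2)
     (H (ff eps (i + length eps - 1))) (H (ff eps i)) (H (ff eps (Suc i)))"
proof -
  have m: "ee eps (j mod length eps) = ee eps j" "ff eps (j mod length eps) = ff eps j" for j
    by (simp_all add: ee_def ff_def)
  show "H (quartic eps ee i) = quartic_el ((- 1) ^ eps_at eps i * qbr2)
     (H (ee eps (i + length eps - 1))) (H (ee eps i)) (H (ee eps (Suc i)))"
   "H (quartic eps ff i) = quartic_el ((- 1) ^ eps_at eps i * qbr2)
     (H (ff eps (i + length eps - 1))) (H (ff eps i)) (H (ff eps (Suc i)))"
    by (simp_all add: quartic_def Let_def quartic_el_def map_simps sgn_eps_def mult.assoc m)
qed

abbreviation (input) "alg_rels \<equiv> full_rels (length eps) (eps_at eps) (H (fa_const 1)) (\<lambda>i. H (om eps i))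
    (\<lambda>i. H (omi eps i)) (\<lambda>i. H (ee eps i)) (\<lambda>i. H (ff eps i))"

text \<open>Used in both directions: for \<open>gmap\<close> it extracts the relations that hold in
  the target algebra, and for the evaluation map it turns the merged relations into the vanishing of
  all relators of the source.\<close>

lemma rels_vanish_iff: "(\<forall>x\<in>rels eps. H x = 0) \<longleftrightarrow> alg_rels"
proof -
  have k: "0 < length eps" using nonempty by simp
  \<comment> \<open>The relators number the weights from 1 to the length, while
    \<open>full_rels\<close> indexes them by all naturals; \<open>widx\<close> picks the
    representative in the first range.\<close>
  have wb: "1 \<le> widx eps j" "widx eps j \<le> length eps" for j
    using widx_bounds[OF nonempty] by auto
  note W = om_widx[OF nonempty] qj_eq pairing_eq pair_widx eps_at_widx[OF nonempty]
  show ?thesis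
  proof (rule iffI, subst (asm) ball_rels, elim conjE)
    assume I: "\<forall>a b. 1 \<le> a \<and> a \<le> length eps \<and> 1 \<le> b \<and> b \<le> length eps \<longrightarrow>
        H (fa_sub (fa_mult (om eps a) (om eps b)) (fa_mult (om eps b) (om eps a))) = 0"
      "\<forall>a. 1 \<le> a \<and> a \<le> length eps \<longrightarrow> H (fa_sub (fa_mult (om eps a) (omi eps a)) (fa_const 1)) = 0"
      "\<forall>a. 1 \<le> a \<and> a \<le> length eps \<longrightarrow> H (fa_sub (fa_mult (omi eps a) (om eps a)) (fa_const 1)) = 0"
      "\<forall>i j. i < length eps \<and> 1 \<le> j \<and> j \<le> length eps \<longrightarrow> H (fa_sub (fa_prod [om eps j, ee eps i, omi eps j])
        (fa_smult (qj eps j powi pairing eps i j) (ee eps i))) = 0"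
      "\<forall>i j. i < length eps \<and> 1 \<le> j \<and> j \<le> length eps \<longrightarrow> H (fa_sub (fa_prod [om eps j, ff eps i, omi eps j])
        (fa_smult (qj eps j powi (- pairing eps i j)) (ff eps i))) = 0"
      "\<forall>i j. i < length eps \<and> j < length eps \<longrightarrow>
        H (fa_sub (fa_sub (fa_mult (ee eps i) (ff eps j)) (fa_mult (ff eps j) (ee eps i)))
          (if i = j then fa_smult (inverse (qv - inverse qv)) (fa_sub (kk eps i) (kki eps i))
           else fa_const 0)) = 0"
    assume J: "\<forall>i. i < length eps \<and> \<not> even_idx eps i \<longrightarrow> H (fa_mult (ee eps i) (ee eps i)) = 0"
      "\<forall>i. i < length eps \<and> \<not> even_idx eps i \<longrightarrow> H (fa_mult (ff eps i) (ff eps i)) = 0"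
      "\<forall>i j. i < length eps \<and> j < length eps \<and> i \<noteq> j \<and> \<not> adjacent (length eps) i j \<longrightarrow>
        H (fa_sub (fa_mult (ee eps i) (ee eps j)) (fa_mult (ee eps j) (ee eps i))) = 0"
      "\<forall>i j. i < length eps \<and> j < length eps \<and> i \<noteq> j \<and> \<not> adjacent (length eps) i j \<longrightarrow>
        H (fa_sub (fa_mult (ff eps i) (ff eps j)) (fa_mult (ff eps j) (ff eps i))) = 0"
      "\<forall>i j. i < length eps \<and> j < length eps \<and> even_idx eps i \<and> adjacent (length eps) i j \<longrightarrow> H (serre eps ee i j) = 0"
      "\<forall>i j. i < length eps \<and> j < length eps \<and> even_idx eps i \<and> adjacent (length eps) i j \<longrightarrow> H (serre eps ff i j) = 0"
      "\<forall>i. i < length eps \<and> \<not> even_idx eps i \<longrightarrow> H (quartic eps ee i) = 0"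
      "\<forall>i. i < length eps \<and> \<not> even_idx eps i \<longrightarrow> H (quartic eps ff i) = 0"
    note J = J[unfolded even_idx_def map_serre map_quartic]
    show alg_rels
    proof (rule full_relsI)
      show "half_rels (length eps) (eps_at eps) (\<lambda>i. H (ee eps i))"
      proof (rule half_relsI)
        fix i j assume ij: "i < length eps" "j < length eps"
        show "H (ee eps i) * H (ee eps j) = H (ee eps j) * H (ee eps i)"
          if "i \<noteq> j" "\<not> adjacent (length eps) i j"
          using J(3)[rule_format, of i j] ij that by (simp add: map_simps)
        show "serre_el ((- 1) ^ eps_at eps i * qbr2) (H (ee eps i)) (H (ee eps j)) = 0"
          if "eps_at eps i = eps_at eps (Suc i)" "adjacent (length eps) i j"
          using J(5)[rule_format, of i j] ij that by blast
      next
        fix i assume i: "i < length eps" "eps_at eps i \<noteq> eps_at eps (Suc i)"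
        show "H (ee eps i) * H (ee eps i) = 0"
          using J(1)[rule_format, of i] i by (simp add: map_simps)
        show "quartic_el ((- 1) ^ eps_at eps i * qbr2) (H (ee eps (i + length eps - 1)))
            (H (ee eps i)) (H (ee eps (Suc i))) = 0"
          using J(7)[rule_format, of i] i by blast
      qed (simp_all only: gens_periodic gens_periodic(5)[OF nonempty] k)
      show "half_rels (length eps) (eps_at eps) (\<lambda>i. H (ff eps i))"
      proof (rule half_relsI)
        fix i j assume ij: "i < length eps" "j < length eps"
        show "H (ff eps i) * H (ff eps j) = H (ff eps j) * H (ff eps i)"
          if "i \<noteq> j" "\<not> adjacent (length eps) i j"
          using J(4)[rule_format, of i j] ij that by (simp add: map_simps)
        show "serre_el ((- 1) ^ eps_at eps i * qbr2) (H (ff eps i)) (H (ff eps j)) = 0"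
          if "eps_at eps i = eps_at eps (Suc i)" "adjacent (length eps) i j"
          using J(6)[rule_format, of i j] ij that by blast
      next
        fix i assume i: "i < length eps" "eps_at eps i \<noteq> eps_at eps (Suc i)"
        show "H (ff eps i) * H (ff eps i) = 0"
          using J(2)[rule_format, of i] i by (simp add: map_simps)
        show "quartic_el ((- 1) ^ eps_at eps i * qbr2) (H (ff eps (i + length eps - 1)))
            (H (ff eps i)) (H (ff eps (Suc i))) = 0"
          using J(8)[rule_format, of i] i by blast
      qed (simp_all only: gens_periodic gens_periodic(5)[OF nonempty] k)
    next
      fix i j assume ij: "i < length eps" "j < length eps"
      show "H (om eps i) * H (om eps j) = H (om eps j) * H (om eps i)"
        using I(1)[rule_format, of "widx eps i" "widx eps j"] wb by (simp add: map_simps W)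
      show "H (om eps j) * H (ee eps i) * H (omi eps j)
          = (qparam (eps_at eps j) powi pair (length eps) i j) \<odot> H (ee eps i)"
        using I(4)[rule_format, of i "widx eps j"] wb ij by (simp add: map_simps W mult.assoc)
      show "H (om eps j) * H (ff eps i) * H (omi eps j)
          = (qparam (eps_at eps j) powi (- pair (length eps) i j)) \<odot> H (ff eps i)"
        using I(5)[rule_format, of i "widx eps j"] wb ij by (simp add: map_simps W mult.assoc)
      assume "i \<noteq> j"
      then show "H (ee eps i) * H (ff eps j) = H (ff eps j) * H (ee eps i)"
        using I(6)[rule_format, of i j] ij by (simp add: map_simps)
    next
      fix i assume i: "i < length eps"
      show "H (om eps i) * H (omi eps i) = H (fa_const 1)" "H (omi eps i) * H (om eps i) = H (fa_const 1)"
        using I(2,3)[rule_format, of "widx eps i"] wb by (simp_all add: map_simps W)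
      show "H (ee eps i) * H (ff eps i) - H (ff eps i) * H (ee eps i) = inverse (qv - inverse qv)
          \<odot> (H (om eps i) * H (omi eps (Suc i)) - H (om eps (Suc i)) * H (omi eps i))"
        using I(6)[rule_format, of i i] i by (simp add: map_simps kk_def kki_def)
    qed (simp_all only: gens_periodic gens_periodic(5)[OF nonempty] k)
  next
    assume R: alg_rels
    note D = full_relsD[OF R] and he = half_relsD[OF full_relsD(8)[OF R]]
      and hf = half_relsD[OF full_relsD(9)[OF R]]
    note assoc = D(4)[unfolded mult.assoc] D(5)[unfolded mult.assoc]
    have c: "i < length eps \<Longrightarrow> j < length eps \<Longrightarrow> i \<noteq> j \<Longrightarrow> \<not> adjacent (length eps) i j
          \<Longrightarrow> H (ee eps i) * H (ee eps j) = H (ee eps j) * H (ee eps i)"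
        "i < length eps \<Longrightarrow> j < length eps \<Longrightarrow> i \<noteq> j \<Longrightarrow> \<not> adjacent (length eps) i j
          \<Longrightarrow> H (ff eps i) * H (ff eps j) = H (ff eps j) * H (ff eps i)" for i j
      using he(2)[of i j] hf(2)[of i j] by simp_all
    have s: "eps_at eps i = eps_at eps (Suc i) \<Longrightarrow> adjacent (length eps) i j
          \<Longrightarrow> serre_el ((- 1) ^ eps_at eps (Suc i) * qbr2) (H (ee eps i)) (H (ee eps j)) = 0"
        "eps_at eps i = eps_at eps (Suc i) \<Longrightarrow> adjacent (length eps) i j
          \<Longrightarrow> serre_el ((- 1) ^ eps_at eps (Suc i) * qbr2) (H (ff eps i)) (H (ff eps j)) = 0" for i j
      using he(3)[of i j] hf(3)[of i j] by simp_all
    note q = he(4)[unfolded One_nat_def] hf(4)[unfolded One_nat_def]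
    show "\<forall>x\<in>rels eps. H x = 0"
      unfolding ball_rels
      by (intro conjI allI impI; elim conjE)
        (simp_all add: map_simps map_serre map_quartic D(2,3) qj_eq pairing_eq assoc even_idx_def
          he(1) hf(1) kk_def kki_def D(1) D(6,7)[unfolded eq_iff_diff_eq_0[of "_ * _"]],
          (rule c s q; assumption)+)
  qed
qed

end

section \<open>Evaluation of noncommutative polynomials\<close>

definition gmap :: "nat list \<Rightarrow> elt \<Rightarrow> uprod" where
  "gmap eps x = Abs_uprod (\<lambda>e. if e = eps then cls eps x else \<zero>\<^bsub>Uq e\<^esub>)"

lemma Rep_gmap:
  "x \<in> falg (length eps) \<Longrightarrow> Rep_uprod (gmap eps x) e = (if e = eps then cls eps x else \<zero>\<^bsub>Uq e\<^esub>)"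
  using ring.ring_simprules(2)[OF ring_Uq] by (simp add: gmap_def Abs_uprod_inverse cls_simps)

lemma alg_map_gmap:
  assumes "eps \<noteq> []"
  shows "alg_map uscale eps (gmap eps)"
proof
  show "eps \<noteq> []" by fact
next
  fix x y assume xy: "x \<in> falg (length eps)" "y \<in> falg (length eps)"
  note R = Rep_uscale Rep_uprod_simps Rep_gmap
  show "gmap eps (fa_add x y) = gmap eps x + gmap eps y"
    "gmap eps (fa_mult x y) = gmap eps x * gmap eps y"
    using xy ring.ring_simprules(2)[OF ring_Uq]
    by (auto intro!: uprod_eqI simp: R cls_simps ring.ring_simprules(8,24)[OF ring_Uq])
next
  fix x c assume x: "x \<in> falg (length eps)"
  have "cls eps (fa_smult c x) = cls eps (fa_const c) \<otimes>\<^bsub>Uq eps\<^esub> cls eps x"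
    using x by (simp flip: cls_simps(2) fa_mult_const_left)
  then show "gmap eps (fa_smult c x) = c *\<^sub>U gmap eps x"
    using x by (auto intro!: uprod_eqI simp: Rep_uscale Rep_gmap cls_simps ring.ring_simprules(25)[OF ring_Uq])
qed

lemma gmap_rels: "x \<in> rels eps \<Longrightarrow> gmap eps x = 0"
  using rels_subset[of eps]
  by (intro uprod_eqI) (simp add: Rep_uprod_simps Rep_gmap cls_rels subsetD)

text \<open>Substitution of \<open>\<theta>\<close> for the generators: the homomorphism given by
  the universal property of the free algebra. It is meaningful on finitely supported
  \<open>a\<close>.\<close>

definition ev :: "(ugen \<Rightarrow> uprod) \<Rightarrow> elt \<Rightarrow> uprod" where
  "ev \<theta> a = (\<Sum>v | a v \<noteq> 0. a v *\<^sub>U prod_list (map \<theta> v))"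

lemma ev_superset:
  assumes "finite S" "{v. a v \<noteq> 0} \<subseteq> S"
  shows "ev \<theta> a = (\<Sum>v\<in>S. a v *\<^sub>U prod_list (map \<theta> v))"
  unfolding ev_def by (rule sum.mono_neutral_left) (use assms in auto)

lemma finite_support: "a \<in> falg k \<Longrightarrow> finite {v. a v \<noteq> 0}"
  by (simp add: falg_iff)

lemma ev_add:
  assumes "a \<in> falg k" "b \<in> falg k"
  shows "ev \<theta> (fa_add a b) = ev \<theta> a + ev \<theta> b"
proof -
  define S where "S = {v. a v \<noteq> 0} \<union> {v. b v \<noteq> 0}"
  have S: "finite S" "{v. a v \<noteq> 0} \<subseteq> S" "{v. b v \<noteq> 0} \<subseteq> S" "{v. fa_add a b v \<noteq> 0} \<subseteq> S"
    using assms by (auto simp: S_def finite_support fa_add_def)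
  have "ev \<theta> (fa_add a b) = (\<Sum>v\<in>S. fa_add a b v *\<^sub>U prod_list (map \<theta> v))"
    by (rule ev_superset[OF S(1,4)])
  also have "\<dots> = (\<Sum>v\<in>S. a v *\<^sub>U prod_list (map \<theta> v)) + (\<Sum>v\<in>S. b v *\<^sub>U prod_list (map \<theta> v))"
    by (simp add: fa_add_def U.sc_add_left sum.distrib)
  finally show ?thesis
    by (simp only: ev_superset[OF S(1,2)] ev_superset[OF S(1,3)])
qed

lemma uscale_sum: "c *\<^sub>U sum f A = (\<Sum>x\<in>A. c *\<^sub>U f x)"
  by (induction A rule: infinite_finite_induct) (simp_all add: U.sc_add_right)

lemma ev_smult:
  assumes "a \<in> falg k"
  shows "ev \<theta> (fa_smult c a) = c *\<^sub>U ev \<theta> a"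
proof -
  have S: "{v. fa_smult c a v \<noteq> 0} \<subseteq> {v. a v \<noteq> 0}"
    by (auto simp: fa_smult_def)
  have "ev \<theta> (fa_smult c a) = (\<Sum>v | a v \<noteq> 0. fa_smult c a v *\<^sub>U prod_list (map \<theta> v))"
    by (rule ev_superset[OF finite_support[OF assms] S])
  then show ?thesis
    by (simp add: ev_def uscale_sum U.sc_sc fa_smult_def)
qed

lemma ev_gen: "ev \<theta> (fa_gen g) = \<theta> g"
  by (simp add: ev_def fa_gen_def U.sc_one)

lemma ev_const_1: "ev \<theta> (fa_const 1) = 1"
  by (simp add: ev_def fa_const_def U.sc_one)

lemma ev_mult:
  assumes "a \<in> falg k" "b \<in> falg k"
  shows "ev \<theta> (fa_mult a b) = ev \<theta> a * ev \<theta> b"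
proof -
  let ?P = "\<lambda>v. prod_list (map \<theta> v)"
  define A where "A = {v. a v \<noteq> 0}"
  define B where "B = {v. b v \<noteq> 0}"
  define S where "S = (\<lambda>(u, v). u @ v) ` (A \<times> B)"
  have fin: "finite (A \<times> B)" "finite S"
    using assms by (auto simp: A_def B_def S_def finite_support)
  have S: "{w. fa_mult a b w \<noteq> 0} \<subseteq> S"
    using fa_mult_nonzeroD by (fastforce simp: S_def A_def B_def)
  have coeff: "fa_mult a b w = (\<Sum>(u, v)\<in>{p \<in> A \<times> B. (case p of (u, v) \<Rightarrow> u @ v) = w}. a u * b v)" for w
    unfolding fa_mult_splits
    by (rule sum.mono_neutral_right[OF finite_splits]) (auto simp: splits_def A_def B_def)
  have "ev \<theta> (fa_mult a b) = (\<Sum>w\<in>S. fa_mult a b w *\<^sub>U ?P w)"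
    by (rule ev_superset[OF fin(2) S])
  also have "\<dots> = (\<Sum>w\<in>S. \<Sum>(u, v)\<in>{p \<in> A \<times> B. (case p of (u, v) \<Rightarrow> u @ v) = w}. (a u * b v) *\<^sub>U ?P (u @ v))"
  proof (rule sum.cong[OF refl])
    fix w
    have scale: "sum f T *\<^sub>U x = (\<Sum>p\<in>T. f p *\<^sub>U x)" for f :: "_ \<Rightarrow> Qq" and T x
      by (induction T rule: infinite_finite_induct) (simp_all add: U.sc_add_left)
    show "fa_mult a b w *\<^sub>U ?P w
        = (\<Sum>(u, v)\<in>{p \<in> A \<times> B. (case p of (u, v) \<Rightarrow> u @ v) = w}. (a u * b v) *\<^sub>U ?P (u @ v))"
      unfolding coeff scale by (rule sum.cong) auto
  qed
  \<comment> \<open>The pairs of words were grouped by their concatenation \<open>w\<close>; the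
    groups exhaust \<open>A \<times> B\<close>.\<close>
  also have "\<dots> = (\<Sum>(u, v)\<in>A \<times> B. (a u * b v) *\<^sub>U ?P (u @ v))"
    by (rule sum.group[OF fin]) (simp add: S_def)
  also have "\<dots> = (\<Sum>u\<in>A. \<Sum>v\<in>B. (a u *\<^sub>U ?P u) * (b v *\<^sub>U ?P v))"
    by (simp add: sum.cartesian_product U.sc_mult_left U.sc_mult_right U.sc_sc mult.commute)
  also have "\<dots> = ev \<theta> a * ev \<theta> b"
    by (simp add: ev_def A_def B_def sum_product)
  finally show ?thesis .
qed

section \<open>Homomorphisms out of the quotient algebra\<close>

lemma gmap_one_central:
  fixes eps and x y :: uprod
  defines "Z \<equiv> gmap eps (fa_const 1)"
  shows "Z * x = x * Z" "Z * Z = Z"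
proof -
  have Z: "Rep_uprod Z e = (if e = eps then \<one>\<^bsub>Uq e\<^esub> else \<zero>\<^bsub>Uq e\<^esub>)" for e
    by (simp add: Z_def Rep_gmap cls_simps)
  show "Z * x = x * Z"
    by (rule uprod_eqI) (simp add: Rep_uprod_simps Z ring.ring_simprules(12,24,25)[OF ring_Uq]
        monoid.r_one[OF ring.is_monoid[OF ring_Uq]])
  show "Z * Z = Z"
    by (rule uprod_eqI) (simp add: Rep_uprod_simps Z ring.ring_simprules(2,6,12,24)[OF ring_Uq])
qed

text \<open>Multiplication by a central idempotent preserves products.\<close>

lemma alg_map_ev:
  assumes "eps' \<noteq> []"
  shows "alg_map uscale eps' (\<lambda>x. gmap eps (fa_const 1) * ev \<theta> x)"
proof
  show "eps' \<noteq> []" by fact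
next
  fix x y assume xy: "x \<in> falg (length eps')" "y \<in> falg (length eps')"
  let ?Z = "gmap eps (fa_const 1)"
  show "?Z * ev \<theta> (fa_add x y) = ?Z * ev \<theta> x + ?Z * ev \<theta> y"
    by (simp add: ev_add[OF xy] distrib_left)
  have "?Z * ev \<theta> x * (?Z * ev \<theta> y) = ?Z * (ev \<theta> x * ?Z) * ev \<theta> y"
    by (simp only: mult.assoc)
  also have "\<dots> = ?Z * ?Z * (ev \<theta> x * ev \<theta> y)"
    by (simp only: gmap_one_central(1)[of eps "ev \<theta> x", symmetric] mult.assoc)
  finally show "?Z * ev \<theta> (fa_mult x y) = ?Z * ev \<theta> x * (?Z * ev \<theta> y)"
    by (simp add: ev_mult[OF xy] gmap_one_central(2))
next
  fix x c assume "x \<in> falg (length eps')"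
  then show "gmap eps (fa_const 1) * ev \<theta> (fa_smult c x) = c *\<^sub>U (gmap eps (fa_const 1) * ev \<theta> x)"
    by (simp add: ev_smult U.sc_mult_right)
qed

text \<open>The component \<open>eps\<close> of \<open>ev \<theta>\<close> is a unital homomorphism
  on the free algebra. The idempotent acts as the identity on that component, so vanishing after the
  cut gives vanishing there.\<close>

lemma factor_through_Uq:
  assumes "eps' \<noteq> []" and zero: "\<And>x. x \<in> rels eps' \<Longrightarrow> gmap eps (fa_const 1) * ev \<theta> x = 0"
  shows "\<exists>\<phi>. \<phi> \<in> ring_hom (Uq eps') (Uq eps) \<and>
    (\<forall>x\<in>falg (length eps'). \<phi> (cls eps' x) = Rep_uprod (ev \<theta> x) eps)"
proof -
  have comp: "Rep_uprod (gmap eps (fa_const 1) * x) eps = Rep_uprod x eps" for x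
    by (simp add: Rep_uprod_simps Rep_gmap cls_simps ring.ring_simprules(12)[OF ring_Uq])
  have "ring_hom_ring (free_alg (length eps')) (Uq eps) (\<lambda>x. Rep_uprod (ev \<theta> x) eps)"
    by (rule ring_hom_ringI[OF ring_free_alg ring_Uq])
      (simp_all add: ev_mult ev_add ev_const_1 Rep_uprod_simps)
  then show ?thesis
    unfolding Uq_def[of eps'] cls_def[of eps']
  proof (rule genideal_quotient_factor[OF _ rels_subset])
    fix x assume "x \<in> rels eps'"
    then show "Rep_uprod (ev \<theta> x) eps = \<zero>\<^bsub>Uq eps\<^esub>"
      using zero[of x] comp[of "ev \<theta> x"] by (simp add: Rep_uprod_simps(1))
  qed
qed

section \<open>Cyclic renumbering\<close>

lemma mod_add_left_cancel:
  fixes c i j k :: nat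
  shows "(c + i) mod k = (c + j) mod k \<longleftrightarrow> i mod k = j mod k"
proof -
  have "(int (c + i) mod int k = int (c + j) mod int k) \<longleftrightarrow> (int i mod int k = int j mod int k)"
    by (simp add: mod_eq_dvd_iff)
  then show ?thesis by (simp only: of_nat_mod[symmetric] of_nat_eq_iff)
qed

lemma adjacent_shift: "adjacent k (c + i) (c + j) \<longleftrightarrow> adjacent k i j"
  by (simp add: adjacent_def mod_add_left_cancel flip: add_Suc_right)

lemma pair_shift: "pair k (c + i) (c + j) = pair k i j"
  by (simp add: pair_def mod_add_left_cancel flip: add_Suc_right)

context q_scaled_ring
begin

lemma half_rels_shift:
  assumes "half_rels k \<eta> x" "0 < k"
  shows "half_rels k (\<lambda>i. \<eta> (c + i)) (\<lambda>i. x (c + i))"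
  unfolding half_rels_def
proof (intro conjI allI impI)
  note R = half_relsD[OF assms(1)]
  fix i j
  show "x (c + i) * x (c + i) = 0" if "\<eta> (c + i) \<noteq> \<eta> (c + Suc i)"
    using R(1)[of "c + i"] that by simp
  show "x (c + i) * x (c + j) = x (c + j) * x (c + i)" if "i mod k \<noteq> j mod k" "\<not> adjacent k i j"
    using R(2)[of "c + i" "c + j"] that by (simp add: mod_add_left_cancel adjacent_shift)
  show "serre_el ((- 1) ^ \<eta> (c + i) * qbr2) (x (c + i)) (x (c + j)) = 0"
    if "\<eta> (c + i) = \<eta> (c + Suc i)" "adjacent k i j"
    using R(3)[of "c + i" "c + j"] that by (simp add: adjacent_shift)
  have "c + (i + k - 1) = c + i + k - 1" using assms(2) by simp
  then show "quartic_el ((- 1) ^ \<eta> (c + i) * qbr2) (x (c + (i + k - 1))) (x (c + i)) (x (c + Suc i)) = 0"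
    if "\<eta> (c + i) \<noteq> \<eta> (c + Suc i)"
    using R(4)[of "c + i"] that unfolding add_Suc_right by metis
qed

lemma full_rels_shift:
  assumes R: "full_rels k \<eta> Z W Wi e f" and k: "0 < k"
  shows "full_rels k (\<lambda>i. \<eta> (c + i)) Z (\<lambda>i. W (c + i)) (\<lambda>i. Wi (c + i)) (\<lambda>i. e (c + i)) (\<lambda>i. f (c + i))"
  unfolding full_rels_def
proof (intro conjI allI)
  note D = full_relsD[OF R]
  fix i j
  show "W (c + i) * W (c + j) = W (c + j) * W (c + i)" by (rule D(1))
  show "W (c + i) * Wi (c + i) = Z" "Wi (c + i) * W (c + i) = Z" by (rule D(2), rule D(3))
  show "W (c + j) * e (c + i) * Wi (c + j) = (qparam (\<eta> (c + j)) powi pair k i j) \<odot> e (c + i)"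
    using D(4)[of "c + j" "c + i"] by (simp only: pair_shift)
  show "W (c + j) * f (c + i) * Wi (c + j) = (qparam (\<eta> (c + j)) powi (- pair k i j)) \<odot> f (c + i)"
    using D(5)[of "c + j" "c + i"] by (simp only: pair_shift)
  show "e (c + i) * f (c + j) - f (c + j) * e (c + i) = (if i mod k = j mod k
      then inverse (qv - inverse qv) \<odot> (W (c + i) * Wi (c + Suc i) - W (c + Suc i) * Wi (c + i)) else 0)"
    using R unfolding full_rels_def add_Suc_right by (metis mod_add_left_cancel)
  show "half_rels k (\<lambda>i. \<eta> (c + i)) (\<lambda>i. e (c + i))" "half_rels k (\<lambda>i. \<eta> (c + i)) (\<lambda>i. f (c + i))"
    using half_rels_shift[OF _ k] D(8,9) by blast+
qed

end

section \<open>Images, parities and weights in coordinates centred at the deleted position\<close>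

lemma Dc_next:
  assumes "3 \<le> length eps" "Suc i mod length eps = j mod length eps"
  shows "Dc eps i j = inverse (qparam (eps_at eps j))"
proof -
  let ?k = "length eps"
  have ne: "eps \<noteq> []" using assms(1) by auto
  have at: "eps_at eps (Suc i) = eps_at eps j"
    using mod_cong_periodic[of "eps_at eps" ?k] gens_periodic(5)[OF ne] assms(2) by metis
  \<comment> \<open>With at least three nodes the residues of i, i+1 and i+2 are distinct. Hence the
    root at j = i+1 pairs to 0 with index i and to 1 with index i+1, which leaves D = 1/q_j.\<close>
  have "i mod ?k \<noteq> Suc i mod ?k" "i mod ?k \<noteq> Suc (Suc i) mod ?k" "Suc i mod ?k \<noteq> Suc (Suc i) mod ?k"
    using mod_add_left_cancel[of i 0 ?k 1] mod_add_left_cancel[of i 0 ?k 2] mod_add_left_cancel[of i 1 ?k 2] assms(1)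
    by simp_all
  moreover have "Suc j mod ?k = Suc (Suc i) mod ?k"
    using mod_Suc_eq[of j ?k] mod_Suc_eq[of "Suc i" ?k] assms(2) by simp
  ultimately have "pairing eps j i = 0" "pairing eps j (Suc i) = 1"
    using assms(2) by (simp_all add: pairing_eq pair_def)
  then show ?thesis
    by (simp add: Dc_def qj_eq at power_int_minus)
qed

lemma kk_periodic: "kk eps (i + length eps) = kk eps i"
  using gens_periodic(1)[of eps i] gens_periodic(2)[of eps "Suc i"] by (simp add: kk_def)

text \<open>Counting \<open>x\<close> cyclically from the merged node removes the case distinction
  on \<open>r\<close>. For \<open>r\<close> equal to the length, the merged node gets number 0
  because \<open>r - 1\<close> wraps round modulo the new length.\<close>

lemma images_shift:
  assumes "4 \<le> length eps" "1 \<le> r" "r \<le> length eps" "x < length eps - 1"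
    and j: "j = (r - 1 + x) mod (length eps - 1)"
  shows "Kimg eps r j = (if x = 0 then fa_mult (kk eps (r - 1)) (kk eps r) else kk eps (r + x))"
    "Eimg eps r j = (if x = 0 then qcomm (inverse (qparam (eps_at eps r))) (ee eps (r - 1)) (ee eps r)
       else ee eps (r + x))"
    "Fimg eps r j = (if x = 0 then qcomm (qparam (eps_at eps r)) (ff eps r) (ff eps (r - 1))
       else ff eps (r + x))"
proof -
  let ?n = "length eps"
  have ne: "eps \<noteq> []" using assms(1) by auto
  have "Suc (?n - 1) = ?n" using assms by simp
  then have D: "Dc eps (r - 1) r = inverse (qparam (eps_at eps r))"
      "Dc eps (?n - 1) 0 = inverse (qparam (eps_at eps 0))"
    using assms by (intro Dc_next; simp)+
  have p0: "kk eps ?n = kk eps 0" "ee eps ?n = ee eps 0" "ff eps ?n = ff eps 0" "eps_at eps ?n = eps_at eps 0"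
    using kk_periodic[of eps 0] gens_periodic(3-5)[of eps 0] ne by simp_all
  have jv: "j = (if r - 1 + x < ?n - 1 then r - 1 + x else r + x - ?n)"
    using assms by (auto simp: mod_if)
  have "Kimg eps r j = (if x = 0 then fa_mult (kk eps (r - 1)) (kk eps r) else kk eps (r + x)) \<and>
    Eimg eps r j = (if x = 0 then qcomm (inverse (qparam (eps_at eps r))) (ee eps (r - 1)) (ee eps r)
       else ee eps (r + x)) \<and>
    Fimg eps r j = (if x = 0 then qcomm (qparam (eps_at eps r)) (ff eps r) (ff eps (r - 1))
       else ff eps (r + x))"
  proof (cases "r - 1 + x < ?n - 1")
    case True
    then have j': "j = r - 1 + x" and rn: "r \<noteq> ?n" using jv assms by auto
    show ?thesis
      using assms(1-3) rn True D by (auto simp: j' Kimg_def Eimg_def Fimg_def Let_def)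
  next
    case False
    \<comment> \<open>Past the wrap both numberings agree: \<open>r - 1 + x\<close> drops by the new
      length and \<open>r + x\<close> by the old one.\<close>
    then have j': "r + x = j + ?n" and r1: "r \<noteq> 1" and jr: "x \<noteq> 0 \<Longrightarrow> j + 2 \<le> r" and x0: "x = 0 \<Longrightarrow> r = ?n \<and> j = 0"
      using jv assms by auto
    have p: "kk eps (r + x) = kk eps j" "ee eps (r + x) = ee eps j" "ff eps (r + x) = ff eps j"
      unfolding j' by (simp_all add: kk_periodic gens_periodic)
    show ?thesis
    proof (cases "x = 0")
      case True
      then show ?thesis
        using x0 r1 D p0 by (auto simp: Kimg_def Eimg_def Fimg_def Let_def)
    next
      case False
      have "r = ?n \<Longrightarrow> j \<noteq> 0" using j' False by auto
      then show ?thesis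
        using False jr r1 p by (auto simp: Kimg_def Eimg_def Fimg_def Let_def)
    qed
  qed
  then show "Kimg eps r j = (if x = 0 then fa_mult (kk eps (r - 1)) (kk eps r) else kk eps (r + x))"
    "Eimg eps r j = (if x = 0 then qcomm (inverse (qparam (eps_at eps r))) (ee eps (r - 1)) (ee eps r)
       else ee eps (r + x))"
    "Fimg eps r j = (if x = 0 then qcomm (qparam (eps_at eps r)) (ff eps r) (ff eps (r - 1))
       else ff eps (r + x))"
    by blast+
qed

text \<open>The merged node keeps the parity at \<open>r - 1\<close>, which is
  \<open>r + (length eps - 1)\<close> up to a period; the parity at \<open>r\<close> is the one that
  disappears.\<close>

lemma eps_at_del_shift:
  assumes "2 \<le> length eps" "1 \<le> r" "r \<le> length eps"
  shows "eps_at (eps_del eps r) (r - 1 + x)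
    = merge_seq (length eps) (eps_at eps (r + (length eps - 1))) (\<lambda>i. eps_at eps (r + i)) x"
proof -
  let ?n = "length eps" and ?eps = "eps_del eps r"
  have len: "length ?eps = ?n - 1" using assms by (simp add: eps_del_def)
  have nth: "?eps ! m = (if m < r - 1 then eps ! m else eps ! Suc m)" if "m < ?n - 1" for m
    using that assms by (auto simp: eps_del_def nth_append min_def)
  have ne: "?eps \<noteq> []" "eps \<noteq> []" using len assms by auto
  define y where "y = x mod (?n - 1)"
  define z where "z = (if y = 0 then ?n - 1 else y)"
  have z: "1 \<le> z" "z \<le> ?n - 1" using assms by (auto simp: z_def y_def less_imp_le)
  have "eps_at ?eps (r - 1 + x) = eps_at ?eps (r - 1 + z)"
  proof -
    have "(r - 1 + x) mod (?n - 1) = (r - 1 + z) mod (?n - 1)"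
      by (simp add: mod_add_left_cancel z_def y_def)
    moreover have "eps_at ?eps (m mod (?n - 1)) = eps_at ?eps m" for m
      by (rule mod_cong_periodic) (use gens_periodic(5)[OF ne(1)] len in simp)
    ultimately show ?thesis by metis
  qed
  also have "\<dots> = eps_at eps (r + z)"
  proof -
    \<comment> \<open>List positions are one less than indices. Both lists wrap round exactly when
      \<open>r + z\<close> exceeds the old length.\<close>
    have a: "(r - 1 + z + (?n - 1) - 1) mod (?n - 1) = (if r + z \<le> ?n then r + z - 2 else r + z - 1 - ?n)"
    proof -
      have "r - 1 + z + (?n - 1) - 1 = (r + z - 2) + (?n - 1)" using assms z by simp
      then have "(r - 1 + z + (?n - 1) - 1) mod (?n - 1) = (r + z - 2) mod (?n - 1)" by simp
      moreover have "(r + z - 2) mod (?n - 1) = (if r + z \<le> ?n then r + z - 2 else r + z - 1 - ?n)"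
        using assms z le_mod_geq[of "?n - 1" "r + z - 2"] by auto
      ultimately show ?thesis by (rule trans)
    qed
    have b: "(r + z + ?n - 1) mod ?n = (if r + z \<le> ?n then r + z - 1 else r + z - 1 - ?n)"
    proof -
      have "r + z + ?n - 1 = (r + z - 1) + ?n" using assms z by simp
      then have "(r + z + ?n - 1) mod ?n = (r + z - 1) mod ?n" by simp
      moreover have "(r + z - 1) mod ?n = (if r + z \<le> ?n then r + z - 1 else r + z - 1 - ?n)"
        using assms z le_mod_geq[of ?n "r + z - 1"] by auto
      ultimately show ?thesis by (rule trans)
    qed
    show ?thesis
    proof (cases "r + z \<le> ?n")
      case True
      have "?eps ! (r + z - 2) = eps ! Suc (r + z - 2)"
      proof -
        have "\<not> r + z - 2 < r - 1" "r + z - 2 < ?n - 1" using assms z True by linarith+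
        then show ?thesis using nth[of "r + z - 2"] by simp
      qed
      moreover have "Suc (r + z - 2) = r + z - 1" using assms z by simp
      ultimately show ?thesis
        unfolding eps_at_def len a b using True by simp
    next
      case False
      then have "r + z - 1 - ?n < r - 1" "r + z - 1 - ?n < ?n - 1"
        using assms z by linarith+
      then have "?eps ! (r + z - 1 - ?n) = eps ! (r + z - 1 - ?n)"
        using nth[of "r + z - 1 - ?n"] by simp
      then show ?thesis
        unfolding eps_at_def len a b using False by simp
    qed
  qed
  finally show ?thesis
    by (simp add: merge_seq_def z_def y_def)
qed

text \<open>The conditional is the increasing renumbering that skips the position \<open>r\<close>.
  In centred coordinates it is \<open>r + z\<close> up to one period, so both sides name the same
  weight.\<close>

lemma widx_del_shift:
  fixes eps :: "nat list" and r x :: nat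
  assumes "2 \<le> length eps" "1 \<le> r" "r \<le> length eps"
  defines "m \<equiv> widx (eps_del eps r) (r - 1 + x)"
    and "z \<equiv> (if x mod (length eps - 1) = 0 then length eps - 1 else x mod (length eps - 1))"
  shows "(if m < r then m else Suc m) = r + z \<or> (if m < r then m else Suc m) + length eps = r + z"
proof -
  let ?n = "length eps"
  have len: "length (eps_del eps r) = ?n - 1" using assms by (simp add: eps_del_def)
  have z: "1 \<le> z" "z \<le> ?n - 1" using assms by (auto simp: z_def less_imp_le)
  have "(r - 1 + x) mod (?n - 1) = (r - 1 + z) mod (?n - 1)"
    by (simp add: mod_add_left_cancel z_def)
  then have m: "m = (if (r - 1 + z) mod (?n - 1) = 0 then ?n - 1 else (r - 1 + z) mod (?n - 1))"
    by (simp add: m_def widx_def len)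
  \<comment> \<open>The multiples of the new length are separate cases because \<open>widx\<close>
    sends residue 0 to the length.\<close>
  consider "r - 1 + z < ?n - 1" | "r - 1 + z = ?n - 1" | "?n - 1 < r - 1 + z" "r - 1 + z < 2 * (?n - 1)"
    | "r - 1 + z = 2 * (?n - 1)"
    using z assms(1-3) by linarith
  then show ?thesis
  proof cases
    case 1
    then have "m = r - 1 + z" using z by (simp add: m)
    then have "\<not> m < r" "Suc m = r + z" using z assms(2) by linarith+
    then show ?thesis by simp
  next
    case 2
    then have "m = ?n - 1" by (simp add: m)
    then have "\<not> m < r" "Suc m = r + z" using 2 z assms(1-3) by linarith+
    then show ?thesis by simp
  next
    case 3
    then have "(r - 1 + z) mod (?n - 1) = r - 1 + z - (?n - 1)"
      using le_mod_geq[of "?n - 1" "r - 1 + z"] by simp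
    then have "m = r - 1 + z - (?n - 1)" using 3 by (simp add: m)
    then have "m < r" "m + ?n = r + z" using 3 z assms(1-3) by linarith+
    then show ?thesis by simp
  next
    case 4
    then have "m = ?n - 1" by (simp add: m)
    then have "m < r" "m + ?n = r + z" using 4 z assms(1-3) by linarith+
    then show ?thesis by simp
  qed
qed

section \<open>Assembling the homomorphism\<close>

lemma periodic_mult_shift:
  assumes "\<And>i. f (i + k) = f (i :: nat)"
  shows "f (i + m * k) = f i"
  using mod_cong_periodic[of f k i] mod_cong_periodic[of f k "i + m * k"] assms by simp

lemma eps_at_in_set: "eps \<noteq> [] \<Longrightarrow> eps_at eps i \<in> set eps"
  by (simp add: eps_at_def)

lemma gmap_qcomm:
  assumes "eps \<noteq> []" "a \<in> falg (length eps)" "b \<in> falg (length eps)"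
  shows "gmap eps (qcomm c a b) = U.qcom c (gmap eps a) (gmap eps b)"
proof -
  interpret G: alg_map uscale eps "gmap eps" by (rule alg_map_gmap[OF assms(1)])
  show ?thesis
    using assms(2,3) by (simp add: qcomm_def U.qcom_def G.map_simps)
qed

lemma gmap_unit:
  assumes "eps \<noteq> []" "a \<in> falg (length eps)"
  shows "gmap eps (fa_const 1) * gmap eps a = gmap eps a" "gmap eps a * gmap eps (fa_const 1) = gmap eps a"
proof -
  interpret G: alg_map uscale eps "gmap eps" by (rule alg_map_gmap[OF assms(1)])
  show "gmap eps (fa_const 1) * gmap eps a = gmap eps a" "gmap eps a * gmap eps (fa_const 1) = gmap eps a"
    using G.map_mult[OF falg_const assms(2), of 1] G.map_mult[OF assms(2) falg_const, of 1]
    by (simp_all add: fa_mult_const_left fa_mult_const_right)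
qed

theorem theorem4p3:
  fixes n r :: nat and eps :: "nat list"
  assumes "4 \<le> n" and "length eps = n" and "set eps \<subseteq> {0, 1}"
    and "1 \<le> r" and "r \<le> n"
    and "n = 4 \<longrightarrow> (set (eps_del eps r) \<subseteq> {0} \<or> set (eps_del eps r) \<subseteq> {1})"
  shows "\<exists>\<phi>. \<phi> \<in> ring_hom (Uq (eps_del eps r)) (Uq eps)
     \<and> (\<forall>c x. x \<in> carrier (Uq (eps_del eps r)) \<longrightarrow>
          \<phi> (cls (eps_del eps r) (fa_const c) \<otimes>\<^bsub>Uq (eps_del eps r)\<^esub> x)
            = cls eps (fa_const c) \<otimes>\<^bsub>Uq eps\<^esub> \<phi> x)
     \<and> (\<forall>j < n - 1.
          \<phi> (cls (eps_del eps r) (kk (eps_del eps r) j)) = cls eps (Kimg eps r j)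
        \<and> \<phi> (cls (eps_del eps r) (ee (eps_del eps r) j)) = cls eps (Eimg eps r j)
        \<and> \<phi> (cls (eps_del eps r) (ff (eps_del eps r) j)) = cls eps (Fimg eps r j))"
proof -
  define eps' where "eps' = eps_del eps r"
  have ne: "eps \<noteq> []" using assms(1,2) by auto
  have len': "length eps' = n - 1" using assms(1,2,4,5) by (simp add: eps'_def eps_del_def)
  have ne': "eps' \<noteq> []" using len' assms(1) by auto
  note [simp] = assms(2)
  note falg = gens_in_falg[OF ne, unfolded assms(2)] gens_in_falg[OF ne', unfolded len']
  define t where "t = inverse (qparam (eps_at eps r))"
  define Z where "Z = gmap eps (fa_const 1)"
  \<comment> \<open>The statement prescribes only the images of the k'_j. The weights themselves are
    sent to the remaining weights in order, skipping the one at \<open>r\<close>.\<close>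
  define s where "s j = (if j < r then j else Suc j)" for j
  define \<theta> where "\<theta> g = (case g of Om j \<Rightarrow> gmap eps (om eps (s j)) | Omi j \<Rightarrow> gmap eps (omi eps (s j))
    | Eg j \<Rightarrow> gmap eps (Eimg eps r j) | Fg j \<Rightarrow> gmap eps (Fimg eps r j))" for g
  \<comment> \<open>\<open>ev \<theta>\<close> sends 1 to the unit of the whole product;
    multiplication by \<open>Z\<close> keeps only the component \<open>eps\<close>.\<close>
  define H where "H x = Z * ev \<theta> x" for x
  have G: "alg_map uscale eps (gmap eps)"
    by (rule alg_map_gmap[OF ne])
  have A: "alg_map uscale eps' H"
    using alg_map_ev[OF ne', of eps \<theta>] by (simp add: H_def[abs_def] Z_def)
  \<comment> \<open>Index 0 is the deleted position \<open>r\<close>, and \<open>n - 1\<close> is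
    its predecessor, as \<open>merge_seq\<close> expects.\<close>
  define W Wi e f where "W i = gmap eps (om eps (r + i))" and "Wi i = gmap eps (omi eps (r + i))"
    and "e i = gmap eps (ee eps (r + i))" and "f i = gmap eps (ff eps (r + i))" for i
  define \<eta> where "\<eta> i = eps_at eps (r + i)" for i
  note unit = gmap_unit[OF ne, unfolded assms(2), folded Z_def]
  have "U.full_rels n (eps_at eps) Z (\<lambda>i. gmap eps (om eps i)) (\<lambda>i. gmap eps (omi eps i))
      (\<lambda>i. gmap eps (ee eps i)) (\<lambda>i. gmap eps (ff eps i))"
    using alg_map.rels_vanish_iff[OF G] gmap_rels by (simp add: Z_def)
  from U.full_rels_shift[OF this, of r] have R: "U.full_rels n \<eta> Z W Wi e f"
    using assms(1) by (simp add: \<eta>_def[abs_def] W_def[abs_def] Wi_def[abs_def] e_def[abs_def] f_def[abs_def])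
  have per: "\<eta> (i + n) = \<eta> i" "W (i + n) = W i" "Wi (i + n) = Wi i" "e (i + n) = e i" "f (i + n) = f i" for i
    using gens_periodic[of eps "r + i"] ne by (simp_all add: \<eta>_def W_def Wi_def e_def f_def add.assoc)
  have del: "eps_at eps' (r - 1 + x) = merge_seq n (\<eta> (n - 1)) \<eta> x" for x
    using eps_at_del_shift[of eps r x] assms(1,4,5) by (simp add: eps'_def \<eta>_def[abs_def])
  have rng: "\<eta> i \<in> {0, 1}" for i
    using eps_at_in_set[OF ne] assms(3) by (auto simp: \<eta>_def)
  have homog: "\<eta> 1 = \<eta> 2 \<and> \<eta> 2 = \<eta> 3" if n4: "n = 4"
  proof -
    obtain c where "set eps' \<subseteq> {c}"
      using assms(6) n4 unfolding eps'_def by blast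
    then have "eps_at eps' i = eps_at eps' j" for i j
      using eps_at_in_set[OF ne', of i] eps_at_in_set[OF ne', of j] by blast
    then have "merge_seq n (\<eta> (n - 1)) \<eta> i = merge_seq n (\<eta> (n - 1)) \<eta> j" for i j
      by (metis del)
    \<comment> \<open>For \<open>n = 4\<close> the merged parities at 1, 2 and 0 are the original
      ones at 1, 2 and 3.\<close>
    from this[of 1 2] this[of 2 0] show ?thesis
      using n4 by (simp add: merge_seq_def)
  qed
  define E where "E = U.qcom t (e (n - 1)) (e 0)"
  define F where "F = U.qcom (inverse t) (f 0) (f (n - 1))"
  have M: "U.full_rels (n - 1) (merge_seq n (\<eta> (n - 1)) \<eta>) Z (merge_seq n (W (n - 1)) W)
      (merge_seq n (Wi (n - 1)) Wi) (merge_seq n E e) (merge_seq n F f)"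
    unfolding E_def F_def
    by (rule U.merge_full_rels[OF assms(1) per rng homog _ _ _ _ _ _ _ R])
      (simp_all add: W_def Wi_def e_def f_def unit falg t_def \<eta>_def)
  have shift_mod: "(r - 1 + x) mod (n - 1) = (r - 1 + x mod (n - 1)) mod (n - 1)" for x
    by (simp add: mod_add_left_cancel)
  have H_gen: "H (fa_gen g) = \<theta> g" if "\<theta> g \<in> gmap eps ` falg n" for g
    using that unit by (auto simp: H_def ev_gen)
  have H_om: "H (om eps' (r - 1 + x)) = merge_seq n (W (n - 1)) W x"
    and H_omi: "H (omi eps' (r - 1 + x)) = merge_seq n (Wi (n - 1)) Wi x" for x
  proof -
    define z where "z = (if x mod (n - 1) = 0 then n - 1 else x mod (n - 1))"
    define m where "m = widx eps' (r - 1 + x)"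
    have "s m = r + z \<or> s m + n = r + z"
      unfolding s_def m_def z_def eps'_def
      by (rule widx_del_shift[of eps r x, unfolded assms(2)]) (use assms(1,4,5) in simp_all)
    then have "om eps (s m) = om eps (r + z)" "omi eps (s m) = omi eps (r + z)"
      using gens_periodic(1,2)[of eps "s m"] by auto
    moreover have "om eps' (r - 1 + x) = fa_gen (Om m)" "omi eps' (r - 1 + x) = fa_gen (Omi m)"
      by (simp_all only: om_def omi_def m_def)
    ultimately have "H (om eps' (r - 1 + x)) = W z" "H (omi eps' (r - 1 + x)) = Wi z"
      using H_gen[of "Om m"] H_gen[of "Omi m"] by (simp_all add: \<theta>_def W_def Wi_def falg)
    then show "H (om eps' (r - 1 + x)) = merge_seq n (W (n - 1)) W x"
      "H (omi eps' (r - 1 + x)) = merge_seq n (Wi (n - 1)) Wi x"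
      by (simp_all add: merge_seq_def z_def)
  qed
  have rE: "ee eps (r - 1) = ee eps (r + (n - 1))" "ff eps (r - 1) = ff eps (r + (n - 1))"
    "kk eps (r - 1) = kk eps (r + (n - 1))"
    using gens_periodic(3,4)[of eps "r - 1"] kk_periodic[of eps "r - 1"] assms(1,4) by simp_all
  have n1: "0 < n - 1" using assms(1) by simp
  have kkW: "gmap eps (kk eps (r + i)) = W i * Wi (Suc i)" for i
    using alg_map.map_mult[OF G, of "om eps (r + i)" "omi eps (Suc (r + i))"]
    by (simp add: kk_def W_def Wi_def falg)
  have images: "Kimg eps r j \<in> falg n \<and> Eimg eps r j \<in> falg n \<and> Fimg eps r j \<in> falg n \<and>
    gmap eps (Kimg eps r j) = merge_seq n (W (n - 1)) W x * merge_seq n (Wi (n - 1)) Wi (Suc x) \<and>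
    gmap eps (Eimg eps r j) = merge_seq n E e x \<and> gmap eps (Fimg eps r j) = merge_seq n F f x"
    if j: "j = (r - 1 + x) mod (n - 1)" for j x
  proof -
    define y where "y = x mod (n - 1)"
    have y: "y < n - 1" using n1 by (simp add: y_def)
    have "j = (r - 1 + y) mod (n - 1)"
      unfolding j y_def by (rule shift_mod)
    note I = images_shift[of eps r y j, unfolded assms(2), OF assms(1,4,5) y this]
    have sx: "Suc x mod (n - 1) = Suc y mod (n - 1)"
      by (simp add: y_def mod_Suc_eq)
    have m: "merge_seq n a b x = (if y = 0 then a else b y)" for a and b :: "nat \<Rightarrow> uprod"
      by (simp add: merge_seq_def y_def)
    show ?thesis
    proof (cases "y = 0")
      case True
      have "Suc x mod (n - 1) = 1" using sx True assms(1) by simp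
      then have ms: "merge_seq n (Wi (n - 1)) Wi (Suc x) = Wi 1" by (simp add: merge_seq_def)
      have "Suc (n - 1) = n" "Wi n = Wi 0" using assms(1) per(3)[of 0] by simp_all
      then have "gmap eps (fa_mult (kk eps (r - 1)) (kk eps r)) = W (n - 1) * Wi 0 * (W 0 * Wi 1)"
        unfolding rE
        using alg_map.map_mult[OF G, of "kk eps (r + (n - 1))" "kk eps (r + 0)"] kkW[of "n - 1"] kkW[of 0]
        by (simp add: falg)
      also have "\<dots> = W (n - 1) * (Wi 0 * W 0) * Wi 1"
        by (simp only: mult.assoc)
      also have "\<dots> = W (n - 1) * Wi 1"
        by (simp only: U.full_relsD(3)[OF R]) (simp add: W_def unit falg)
      finally have "gmap eps (fa_mult (kk eps (r - 1)) (kk eps r)) = W (n - 1) * Wi 1" .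
      moreover have "gmap eps (qcomm (inverse (qparam (eps_at eps r))) (ee eps (r - 1)) (ee eps r)) = E"
        "gmap eps (qcomm (qparam (eps_at eps r)) (ff eps r) (ff eps (r - 1))) = F"
        unfolding rE by (simp_all add: gmap_qcomm[OF ne] falg E_def F_def e_def f_def t_def)
      ultimately show ?thesis
        unfolding I m ms using True by (simp add: qcomm_def falg)
    next
      case False
      have ms: "merge_seq n (Wi (n - 1)) Wi (Suc x) = Wi (Suc y)"
        unfolding merge_seq_def sx using y by (cases "Suc y = n - 1") simp_all
      show ?thesis
        unfolding I m ms using False by (simp add: falg kkW e_def f_def)
    qed
  qed
  have H_E: "H (ee eps' i) = gmap eps (Eimg eps r (i mod (n - 1)))"
    and H_F: "H (ff eps' i) = gmap eps (Fimg eps r (i mod (n - 1)))" for i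
  proof -
    \<comment> \<open>Adding \<open>(r - 1) * (n - 2)\<close> undoes the shift by
      \<open>r - 1\<close> modulo \<open>n - 1\<close> without subtraction.\<close>
    have "i mod (n - 1) = (r - 1 + (i + (r - 1) * (n - 2))) mod (n - 1)"
    proof -
      have "n - 1 = Suc (n - 2)" using assms(1) by simp
      then have "r - 1 + (i + (r - 1) * (n - 2)) = i + (r - 1) * (n - 1)" by simp
      then show ?thesis by (simp only: mod_mult_self1)
    qed
    from images[OF this] have "Eimg eps r (i mod (n - 1)) \<in> falg n" "Fimg eps r (i mod (n - 1)) \<in> falg n"
      by blast+
    then show "H (ee eps' i) = gmap eps (Eimg eps r (i mod (n - 1)))"
      "H (ff eps' i) = gmap eps (Fimg eps r (i mod (n - 1)))"
      using H_gen[of "Eg (i mod (n - 1))"] H_gen[of "Fg (i mod (n - 1))"]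
      by (simp_all add: ee_def[of eps'] ff_def[of eps'] \<theta>_def len')
  qed
  have shifted: "U.full_rels (n - 1) (\<lambda>x. eps_at eps' (r - 1 + x)) Z (\<lambda>x. H (om eps' (r - 1 + x)))
      (\<lambda>x. H (omi eps' (r - 1 + x))) (\<lambda>x. H (ee eps' (r - 1 + x))) (\<lambda>x. H (ff eps' (r - 1 + x)))"
    unfolding del H_om H_omi H_E H_F using images M by simp
  have "U.full_rels (n - 1) (eps_at eps') Z (\<lambda>x. H (om eps' x))
      (\<lambda>x. H (omi eps' x)) (\<lambda>x. H (ee eps' x)) (\<lambda>x. H (ff eps' x))"
  proof -
    \<comment> \<open>The total shift is a multiple of the new period, so the relations return to
      the original numbering.\<close>
    have idx: "r - 1 + ((r - 1) * (n - 2) + i) = i + (r - 1) * (n - 1)" for i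
    proof -
      have "n - 1 = Suc (n - 2)" using assms(1) by simp
      then show ?thesis by (simp only: mult_Suc_right)
    qed
    note per' = gens_periodic[of eps', unfolded len']
    have "eps_at eps' (i + (r - 1) * (n - 1)) = eps_at eps' i" "om eps' (i + (r - 1) * (n - 1)) = om eps' i"
      "omi eps' (i + (r - 1) * (n - 1)) = omi eps' i" "ee eps' (i + (r - 1) * (n - 1)) = ee eps' i"
      "ff eps' (i + (r - 1) * (n - 1)) = ff eps' i" for i
      by (rule periodic_mult_shift; simp only: per' per'(5)[OF ne'])+
    with U.full_rels_shift[OF shifted n1, of "(r - 1) * (n - 2)"]
    show ?thesis by (simp only: idx)
  qed
  moreover have H1: "H (fa_const 1) = Z" by (simp add: H_def ev_const_1)
  ultimately have "\<forall>x\<in>rels eps'. H x = 0"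
    using alg_map.rels_vanish_iff[OF A] by (simp add: len')
  then obtain \<phi> where \<phi>: "\<phi> \<in> ring_hom (Uq eps') (Uq eps)"
    and \<phi>_cls: "\<And>x. x \<in> falg (n - 1) \<Longrightarrow> \<phi> (cls eps' x) = Rep_uprod (ev \<theta> x) eps"
    using factor_through_Uq[OF ne', of eps \<theta>] by (auto simp: H_def Z_def len')
  \<comment> \<open>In the component \<open>eps\<close>, \<open>Z\<close> is the unit, so
    \<open>H x\<close> and \<open>ev \<theta> x\<close> agree there.\<close>
  have \<phi>_eq: "\<phi> (cls eps' x) = cls eps y" if "H x = gmap eps y" "x \<in> falg (n - 1)" "y \<in> falg n" for x y
  proof -
    have "Rep_uprod (H x) eps = cls eps y" using that by (simp add: Rep_gmap)
    then show ?thesis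
      using \<phi>_cls[OF that(2)]
      by (simp add: H_def Z_def Rep_uprod_simps Rep_gmap cls_simps ring.ring_simprules(12)[OF ring_Uq])
  qed
  have "\<phi> (cls eps' (fa_const c) \<otimes>\<^bsub>Uq eps'\<^esub> x) = cls eps (fa_const c) \<otimes>\<^bsub>Uq eps\<^esub> \<phi> x"
    if "x \<in> carrier (Uq eps')" for c x
  proof -
    have "H (fa_const c) = gmap eps (fa_const c)"
      using alg_map.map_const[OF A, of c] alg_map.map_const[OF G, of c] by (simp only: H1 Z_def)
    then have "\<phi> (cls eps' (fa_const c)) = cls eps (fa_const c)"
      by (rule \<phi>_eq) simp_all
    then show ?thesis
      using ring_hom_mult[OF \<phi> _ that, of "cls eps' (fa_const c)"] by (simp add: cls_simps)
  qed
  moreover have "\<phi> (cls eps' (kk eps' j)) = cls eps (Kimg eps r j)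
      \<and> \<phi> (cls eps' (ee eps' j)) = cls eps (Eimg eps r j)
      \<and> \<phi> (cls eps' (ff eps' j)) = cls eps (Fimg eps r j)" if "j < n - 1" for j
  proof -
    define x where "x = j + (r - 1) * (n - 2)"
    have "n - 1 = Suc (n - 2)" using assms(1) by simp
    then have x: "r - 1 + x = j + (r - 1) * (n - 1)" by (simp add: x_def)
    have jx: "j = (r - 1 + x) mod (n - 1)" using that by (simp only: x mod_mult_self1 mod_less)
    note I = images[OF jx]
    have "om eps' (r - 1 + x) = om eps' j" "omi eps' (Suc (r - 1 + x)) = omi eps' (Suc j)"
      using periodic_mult_shift[of "om eps'" "n - 1" j "r - 1"]
        periodic_mult_shift[of "omi eps'" "n - 1" "Suc j" "r - 1"] gens_periodic(1,2)[of eps']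
      by (simp_all only: len' x simp_thms add_Suc[symmetric])
    then have "H (kk eps' j) = H (om eps' (r - 1 + x)) * H (omi eps' (r - 1 + Suc x))"
      using alg_map.map_mult[OF A gens_in_falg(1,2)[OF ne'], of j "Suc j"]
      by (simp add: kk_def)
    then have "H (kk eps' j) = gmap eps (Kimg eps r j)"
      using I by (simp only: H_om H_omi)
    moreover have "H (ee eps' j) = gmap eps (Eimg eps r j)" "H (ff eps' j) = gmap eps (Fimg eps r j)"
      using that by (simp_all add: H_E H_F)
    moreover have "kk eps' j \<in> falg (n - 1)" "ee eps' j \<in> falg (n - 1)" "ff eps' j \<in> falg (n - 1)"
      by (rule falg)+
    ultimately show ?thesis
      using \<phi>_eq[of "kk eps' j" "Kimg eps r j"] \<phi>_eq[of "ee eps' j" "Eimg eps r j"]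
        \<phi>_eq[of "ff eps' j" "Fimg eps r j"] I by (simp only: simp_thms)
  qed
  ultimately show ?thesis
    using \<phi> unfolding eps'_def by blast
qed

end
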